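(* Let $b\geq 2$ and $n\geq 1$ be integers and let $\lambda_{0},\ldots,\lambda_{n-1}\in[1,\infty]$. Then \[ n-1+\frac{1}{\max_{0\leq i\leq n-1}\lambda_{i}}\;\geq\;\dim\Big(\prod_{i=0}^{n-1}\mathscr{V}_{\lambda_{i},(b)}\Big)\;\geq\;\max\Big\{n-1,\ \sum_{i=0}^{n-1}\lambda_{i}^{-1}\Big\}. \] In particular, there is a threshold depending on $n$ such that if all $\lambda_{i}$ are larger than it, then \[ \dim\Big(\prod_{i=0}^{n-1}\mathscr{V}_{\lambda_{i},(b)}\Big)>\sum_{i=0}^{n-1}\dim(\mathscr{V}_{\lambda_{i},(b)}). \] Moreover, for every $n\geq 1$, \[ \lim_{\max\lambda_{i}\to\infty}\dim\Big(\prod_{i=0}^{n-1}\mathscr{V}_{\lambda_{i},(b)}\Big)=n-1,\qquad \lim_{\max\lambda_{i}\to\infty}\dim_{P}\Big(\prod_{i=0}^{n-1}\mathscr{V}_{\lambda_{i},(b)}\Big)=n, \] where the limits are taken over any points $(\lambda_{0},\ldots,\lambda_{n-1})\in[1,\infty]^{n}$ whose maximum tends to infinity.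
   Context: $\dim$ denotes Hausdorff dimension and $\dim_{P}$ packing dimension. For an integer $b\geq 2$ and $\xi\in\mathbb{R}$, $\theta_{b}(\xi)$ is the supremum of all $\mu$ such that there are infinitely many rational numbers of the form $p/b^{N}$ ($p,N$ integers, $N\geq 0$) with $|\xi-p/b^{N}|\leq (b^{N})^{-\mu}$; one has $\theta_b(\xi)\ge 1$ always, with equality for rational $\xi$. For $\lambda\in[1,\infty]$, $\mathscr{V}_{\lambda,(b)}=\{\xi\in\mathbb{R}:\theta_{b}(\xi)=\lambda\}$.
   Formalization: The threshold claim (strict inequality between the dimension of the product and the sum of the dimensions) is stated for n ≥ 2 only, since for n = 1 it would read dim V > dim V, which is false for every finite threshold. *)

theory Defs
  imports "HOL-Analysis.Analysis" "HOL-Library.Going_To_Filter"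
begin

text \<open>
  The term \<open>|U|^s\<close> of a covering sum. For \<open>s = 0\<close> the convention is that it is \<open>1\<close> for
  nonempty \<open>U\<close>, whereas \<open>0 powr 0 = 0\<close> in HOL.
\<close>

definition diam_power :: "real \<Rightarrow> 'a::metric_space set \<Rightarrow> ennreal" where
  "diam_power s U =
     (if U = {} then 0 else if s = 0 then 1 else ennreal (diameter U powr s))"

text \<open>
  Boundedness is required separately because \<open>diameter\<close> is unspecified on unbounded sets.
\<close>

definition hausdorff_pre_measure :: "real \<Rightarrow> real \<Rightarrow> 'a::metric_space set \<Rightarrow> ennreal" where
  "hausdorff_pre_measure s \<delta> A =
     (INF U\<in>{U :: nat \<Rightarrow> 'a set. A \<subseteq> (\<Union>i. U i) \<and> (\<forall>i. bounded (U i) \<and> diameter (U i) \<le> \<delta>)}.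
        \<Sum>i. diam_power s (U i))"

definition hausdorff_measure :: "real \<Rightarrow> 'a::metric_space set \<Rightarrow> ennreal" where
  "hausdorff_measure s A = (SUP \<delta>\<in>{0<..}. hausdorff_pre_measure s \<delta> A)"

definition hausdorff_dim :: "'a::metric_space set \<Rightarrow> ereal" where
  "hausdorff_dim A = Inf {ereal s |s. 0 \<le> s \<and> hausdorff_measure s A = 0}"

text \<open>
  A packing is a family of disjoint closed balls, encoded as a set of pairs (centre, radius).
  Finite families suffice, since a countable sum of nonnegative terms is the supremum of its
  finite partial sums.
\<close>

definition packings :: "real \<Rightarrow> 'a::metric_space set \<Rightarrow> ('a \<times> real) set set" where
  "packings \<delta> A =
     {F. finite F \<and> (\<forall>(x, r)\<in>F. x \<in> A \<and> 0 < r \<and> r \<le> \<delta>) \<and>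
         disjoint_family_on (\<lambda>(x, r). cball x r) F}"

definition packing_pre_measure :: "real \<Rightarrow> 'a::metric_space set \<Rightarrow> ennreal" where
  "packing_pre_measure s A =
     (INF \<delta>\<in>{0<..}. SUP F\<in>packings \<delta> A. \<Sum>(x, r)\<in>F. ennreal ((2 * r) powr s))"

definition packing_measure :: "real \<Rightarrow> 'a::metric_space set \<Rightarrow> ennreal" where
  "packing_measure s A =
     (INF E\<in>{E :: nat \<Rightarrow> 'a set. A \<subseteq> (\<Union>i. E i)}. \<Sum>i. packing_pre_measure s (E i))"

definition packing_dim :: "'a::metric_space set \<Rightarrow> ereal" where
  "packing_dim A = Inf {ereal s |s. 0 \<le> s \<and> packing_measure s A = 0}"

text \<open>
  The infinite set consists of rational numbers, not of pairs \<open>(p, N)\<close>: a number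
  \<open>p / b ^ N\<close> is counted once, although it has infinitely many representations.
\<close>

definition badic_exponent :: "nat \<Rightarrow> real \<Rightarrow> ereal" where
  "badic_exponent b \<xi> =
     Sup {ereal \<mu> |\<mu>. infinite {q :: real. \<exists>(p::int) (N::nat).
            q = real_of_int p / real b ^ N \<and> \<bar>\<xi> - q\<bar> \<le> (real b ^ N) powr (- \<mu>)}}"

definition badic_level_set :: "nat \<Rightarrow> ereal \<Rightarrow> real set" where
  "badic_level_set b l = {\<xi>. badic_exponent b \<xi> = l}"

definition badic_level_prod :: "nat \<Rightarrow> ('n::finite \<Rightarrow> ereal) \<Rightarrow> (real ^ 'n) set" where
  "badic_level_prod b l = {x. \<forall>i. x $ i \<in> badic_level_set b (l i)}"

text \<open>
  The filter of parameters in \<open>[1,\<infinity>]^n\<close> whose maximum tends to infinity. On \<open>ereal\<close> one must use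
  \<open>nhds \<infinity>\<close>, because \<open>at_top\<close> is the principal filter of \<open>{\<infinity>}\<close>. Points having a coordinate
  equal to \<open>\<infinity>\<close> are included.
\<close>

definition max_to_infinity :: "('n::finite \<Rightarrow> ereal) filter" where
  "max_to_infinity = (\<lambda>l. Max (range l)) going_to nhds \<infinity> within {l. \<forall>i. 1 \<le> l i}"

end

theory Submission
  imports Defs
begin

text \<open>
  In fact the Hausdorff dimension of the product is \<open>n - 1 + 1 / max \<lambda>\<^sub>i\<close> and its packing dimension
  is \<open>n\<close>. For the lower bounds let \<open>N\<^sub>k = (k!)\<^sup>3\<close> and consider, in coordinate \<open>i\<close>, the reals whose base \<open>b\<close>
  digits vanish on the blocks \<open>[N\<^sub>k, \<lambda>\<^sub>i N\<^sub>k)\<close> with \<open>k \<equiv> i (mod n)\<close>, are \<open>0, 1\<close> at the positions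
  \<open>2 q\<^sup>2, 2 q\<^sup>2 + 1\<close> outside the blocks, and are arbitrary elsewhere. The blocks force the exponent to be at
  least \<open>\<lambda>\<^sub>i\<close>; the digits \<open>0, 1\<close> prevent longer runs of \<open>0\<close> or of \<open>b - 1\<close>, so that it equals \<open>\<lambda>\<^sub>i\<close>.
  Since the blocks of different coordinates are staggered and \<open>N\<^sub>k\<close> grows superexponentially, at every
  scale only one coordinate loses a positive proportion of its digits, and at the scales \<open>N\<^sub>k\<close> none does.
  Writing the digits of \<open>y\<close> into the free positions gives a map \<open>g\<close> from Euclidean space into the product,
  and Lebesgue measure of preimages under \<open>g\<close> replaces the mass distribution principle. The upper bound
  covers one coordinate of exponent greater than \<open>\<mu>\<close> by the intervals around \<open>p / b\<^sup>N\<close> of radius \<open>b\<close> to the \<open>- \<mu> N\<close>,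
  and the other coordinates by a grid of that mesh.
\<close>

subsection \<open>The b-adic exponent\<close>

lemma finite_badic_near:
  fixes x c :: real
  assumes "0 < b"
  shows "finite {q :: real. \<exists>(p::int) N. N < M \<and> q = p / real b ^ N \<and> \<bar>x - q\<bar> \<le> c}"
proof (rule finite_subset)
  let ?P = "\<lambda>N. {\<lfloor>(x - c) * real b ^ N\<rfloor>..\<lceil>(x + c) * real b ^ N\<rceil>}"
  show "{q :: real. \<exists>(p::int) N. N < M \<and> q = p / real b ^ N \<and> \<bar>x - q\<bar> \<le> c}
          \<subseteq> (\<Union>N<M. (\<lambda>p. real_of_int p / real b ^ N) ` ?P N)"
  proof clarify
    fix p :: int and N
    assume "N < M" "\<bar>x - p / real b ^ N\<bar> \<le> c"
    then have "(x - c) * real b ^ N \<le> p" "p \<le> (x + c) * real b ^ N"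
      using \<open>0 < b\<close> by (auto simp: abs_le_iff field_simps)
    then have "p \<in> ?P N"
      by (simp add: floor_le_iff le_ceiling_iff)
    with \<open>N < M\<close> show "p / real b ^ N \<in> (\<Union>N<M. (\<lambda>p. real_of_int p / real b ^ N) ` ?P N)"
      by blast
  qed
qed auto

text \<open>The exponent counts rational numbers, not pairs \<open>(p, N)\<close>. For
  \<open>N < M\<close> and errors at most 1, which \<open>0 \<le> \<mu>\<close> guarantees, only
  finitely many values \<open>p / b^N\<close> are possible, so an infinite set of approximants
  involves arbitrarily large \<open>N\<close>.\<close>

lemma badic_approximations_unbounded:
  assumes "0 < b" "0 \<le> \<mu>"
    and inf: "infinite {q :: real. \<exists>(p::int) (N::nat). q = p / real b ^ N \<and> \<bar>x - q\<bar> \<le> (real b ^ N) powr (- \<mu>)}"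
  shows "\<exists>N\<ge>M. \<exists>p::int. \<bar>x - p / real b ^ N\<bar> \<le> (real b ^ N) powr (- \<mu>)"
proof (rule ccontr)
  assume neg: "\<not> ?thesis"
  have "{q :: real. \<exists>(p::int) (N::nat). q = p / real b ^ N \<and> \<bar>x - q\<bar> \<le> (real b ^ N) powr (- \<mu>)}
          \<subseteq> {q :: real. \<exists>(p::int) N. N < M \<and> q = p / real b ^ N \<and> \<bar>x - q\<bar> \<le> 1}"
  proof clarify
    fix p :: int and N
    assume le: "\<bar>x - p / real b ^ N\<bar> \<le> (real b ^ N) powr (- \<mu>)"
    then have "N < M" using neg by (meson not_less)
    moreover have "(real b ^ N) powr (- \<mu>) \<le> (real b ^ N) powr 0"
      using assms by (intro powr_mono) auto
    then have "\<bar>x - p / real b ^ N\<bar> \<le> 1" using le assms by simp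
    ultimately show "\<exists>(p'::int) N'. N' < M \<and> p / real b ^ N = p' / real b ^ N' \<and> \<bar>x - p / real b ^ N\<bar> \<le> 1"
      by blast
  qed
  with finite_badic_near[OF assms(1)] inf show False by (meson finite_subset)
qed

lemma badic_approximations_of_less_exponent:
  assumes "0 < b" "0 \<le> \<mu>" "ereal \<mu> < badic_exponent b x"
  shows "\<exists>N\<ge>M. \<exists>p::int. \<bar>x - p / real b ^ N\<bar> \<le> (real b ^ N) powr (- \<mu>)"
proof -
  obtain \<nu> where "\<mu> < \<nu>"
    and inf: "infinite {q :: real. \<exists>(p::int) (N::nat). q = p / real b ^ N \<and> \<bar>x - q\<bar> \<le> (real b ^ N) powr (- \<nu>)}"
    using assms(3) unfolding badic_exponent_def less_Sup_iff by auto
  then obtain N p where "N \<ge> M" "\<bar>x - real_of_int p / real b ^ N\<bar> \<le> (real b ^ N) powr (- \<nu>)"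
    using badic_approximations_unbounded[OF assms(1), of \<nu> x M] assms(2) by auto
  moreover have "(real b ^ N) powr (- \<nu>) \<le> (real b ^ N) powr (- \<mu>)"
    using \<open>\<mu> < \<nu>\<close> assms(1) by (intro powr_mono) auto
  ultimately show ?thesis by (meson order.trans)
qed

lemma badic_exponent_leI:
  assumes "0 < b" "0 \<le> \<mu>"
    and "\<And>N (p::int). M \<le> N \<Longrightarrow> (real b ^ N) powr (- \<mu>) < \<bar>x - p / real b ^ N\<bar>"
  shows "badic_exponent b x \<le> ereal \<mu>"
  using badic_approximations_of_less_exponent[OF assms(1,2), of x M] assms(3)
  by (meson linorder_not_less)

text \<open>The approximants must differ from \<open>x\<close>: a b-adic \<open>x\<close> equals
  some \<open>p / b^N\<close> for all large \<open>N\<close>, but counts only once. A finite set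
  keeps a positive distance \<open>d\<close> from \<open>x\<close>, apart from \<open>x\<close>
  itself, whereas the nonzero errors here tend to 0.\<close>

lemma badic_exponent_geI:
  assumes "2 \<le> b" "0 < \<mu>"
    and approx: "\<And>M. \<exists>N\<ge>M. \<exists>p::int. p / real b ^ N \<noteq> x \<and> \<bar>x - p / real b ^ N\<bar> \<le> (real b ^ N) powr (- \<mu>)"
  shows "ereal \<mu> \<le> badic_exponent b x"
proof -
  let ?Q = "{q :: real. \<exists>(p::int) (N::nat). q = p / real b ^ N \<and> \<bar>x - q\<bar> \<le> (real b ^ N) powr (- \<mu>)}"
  have "infinite ?Q"
  proof
    assume "finite ?Q"
    then obtain d where "d > 0" and d: "\<And>q. q \<in> ?Q \<Longrightarrow> q \<noteq> x \<Longrightarrow> d \<le> dist x q"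
      using finite_set_avoid[of ?Q x] by blast
    have "((\<lambda>N. (real b powr - \<mu>) ^ N) \<longlongrightarrow> 0) sequentially"
      using assms by (intro LIMSEQ_realpow_zero) (auto simp: powr_less_one)
    then have "eventually (\<lambda>N. (real b powr - \<mu>) ^ N < d) sequentially"
      using \<open>d > 0\<close> by (rule order_tendstoD)
    then obtain M where M: "\<And>N. N \<ge> M \<Longrightarrow> (real b powr - \<mu>) ^ N < d"
      by (auto simp: eventually_sequentially)
    obtain N and p :: int where N: "N \<ge> M" "p / real b ^ N \<noteq> x" "\<bar>x - p / real b ^ N\<bar> \<le> (real b ^ N) powr (- \<mu>)"
      using approx by blast
    then have "d \<le> dist x (p / real b ^ N)" by (intro d) auto
    moreover have "(real b ^ N) powr (- \<mu>) = (real b powr - \<mu>) ^ N"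
      using assms by (simp add: powr_realpow[symmetric] powr_powr mult.commute)
    ultimately show False using N M[of N] by (simp add: dist_real_def)
  qed
  then show ?thesis unfolding badic_exponent_def by (intro Sup_upper) auto
qed

text \<open>
  The positions \<open>2 q\<^sup>2\<close> and \<open>2 q\<^sup>2 + 1\<close>: they have density zero, but consecutive ones have ratio
  tending to one.
\<close>

definition double_square :: "nat \<Rightarrow> bool" where
  "double_square j \<longleftrightarrow> (\<exists>q. j div 2 = q\<^sup>2)"

lemma double_square_dense:
  assumes "1 < \<rho>"
  shows "\<exists>M. \<forall>N\<ge>M. \<exists>q. N \<le> 2 * q\<^sup>2 \<and> real (2 * q\<^sup>2 + 2) \<le> \<rho> * real N"
proof -
  \<comment> \<open>For \<open>t = sqrt N\<close> and \<open>q\<close> just above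
    \<open>t / sqrt 2\<close>, one has \<open>2 * q\<^sup>2 + 2 \<le> t\<^sup>2 + 8 * t\<close>. The
    choice of \<open>M\<close> gives \<open>8 \<le> (\<rho> - 1) * t\<close>, which turns this into
    \<open>\<rho> * t\<^sup>2\<close>.\<close>
  define M where "M = nat \<lceil>(8 / (\<rho> - 1))\<^sup>2\<rceil> + 1"
  have "\<exists>q. N \<le> 2 * q\<^sup>2 \<and> real (2 * q\<^sup>2 + 2) \<le> \<rho> * real N" if "N \<ge> M" for N
  proof -
    define t where "t = sqrt N"
    have "(8 / (\<rho> - 1))\<^sup>2 \<le> N" "1 \<le> real N" using that unfolding M_def by linarith+
    then have t: "1 \<le> t" "8 / (\<rho> - 1) \<le> t" "t\<^sup>2 = N"
      unfolding t_def by (auto simp: real_le_rsqrt)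
    define q where "q = nat \<lceil>t / sqrt 2\<rceil>"
    have q: "t / sqrt 2 \<le> q" "q \<le> t / sqrt 2 + 1"
      unfolding q_def using t by (auto intro: order.trans[OF _ of_nat_ceiling] simp: of_nat_nat ceiling_less_iff)
    have "real N = 2 * (t / sqrt 2)\<^sup>2" using t by (simp add: power_divide)
    also have "\<dots> \<le> 2 * q\<^sup>2" using q t by (auto intro!: power_mono)
    finally have "N \<le> 2 * q\<^sup>2" by (metis of_nat_le_iff of_nat_mult of_nat_numeral of_nat_power)
    define w where "w = t / sqrt 2"
    have "w \<le> t" using t by (simp add: w_def field_simps)
    have "(real q)\<^sup>2 \<le> (w + 1)\<^sup>2" using q by (intro power_mono) (auto simp: w_def)
    then have "2 * (real q)\<^sup>2 + 2 \<le> 2 * w\<^sup>2 + 4 * w + 4"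
      by (simp add: power2_sum)
    also have "\<dots> \<le> t\<^sup>2 + 4 * t + 4" using \<open>w \<le> t\<close> by (simp add: w_def power_divide)
    also have "\<dots> \<le> t\<^sup>2 + 8 * t" using t by simp
    also have "\<dots> \<le> t\<^sup>2 + ((\<rho> - 1) * t) * t"
      using t assms by (intro add_left_mono mult_right_mono) (auto simp: field_simps)
    also have "\<dots> = \<rho> * N" using t(3) by (simp add: algebra_simps power2_eq_square flip: t(3))
    finally show ?thesis using \<open>N \<le> 2 * q\<^sup>2\<close> by (intro exI[of _ q]) simp
  qed
  then show ?thesis by blast
qed

text \<open>Only \<open>q \<le> sqrt m\<close> can occur, and each such \<open>q\<close> contributes
  two positions.\<close>

lemma card_double_square_less:
  "real (card {j. j < m \<and> double_square j}) \<le> 2 * sqrt m + 2"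
proof -
  let ?S = "{..nat \<lfloor>sqrt m\<rfloor>}"
  have "{j. j < m \<and> double_square j} \<subseteq> (\<lambda>q. 2 * q\<^sup>2) ` ?S \<union> (\<lambda>q. 2 * q\<^sup>2 + 1) ` ?S"
  proof clarify
    fix j assume "j < m" "double_square j" and j: "j \<notin> (\<lambda>q. 2 * q\<^sup>2 + 1) ` ?S"
    then obtain q where q: "j div 2 = q\<^sup>2" by (auto simp: double_square_def)
    then have "q\<^sup>2 \<le> m" using \<open>j < m\<close> by linarith
    then have "real q \<le> sqrt m" by (metis of_nat_le_iff of_nat_power real_le_rsqrt)
    then have "q \<in> ?S" by (simp add: le_nat_floor)
    moreover have "j = 2 * q\<^sup>2 \<or> j = 2 * q\<^sup>2 + 1" using q by linarith
    ultimately show "j \<in> (\<lambda>q. 2 * q\<^sup>2) ` ?S" using j by blast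
  qed
  then have "card {j. j < m \<and> double_square j} \<le> card ((\<lambda>q. 2 * q\<^sup>2) ` ?S \<union> (\<lambda>q. 2 * q\<^sup>2 + 1) ` ?S)"
    by (intro card_mono) auto
  also have "\<dots> \<le> card ?S + card ?S"
    by (intro order.trans[OF card_Un_le] add_mono card_image_le) auto
  also have "card ?S + card ?S = 2 * (nat \<lfloor>sqrt m\<rfloor> + 1)" by simp
  finally have "real (card {j. j < m \<and> double_square j}) \<le> real (2 * (nat \<lfloor>sqrt m\<rfloor> + 1))"
    by (rule of_nat_mono)
  then have "real (card {j. j < m \<and> double_square j}) \<le> 2 * (real (nat \<lfloor>sqrt m\<rfloor>) + 1)" by simp
  also have "real (nat \<lfloor>sqrt m\<rfloor>) \<le> sqrt m" by simp
  finally show ?thesis by simp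
qed

subsection \<open>Prescribing digits\<close>

text \<open>
  Writes the last base \<open>b\<close> digits of \<open>a\<close> into the positions below \<open>m\<close> that are marked free by \<open>fr\<close>, and the
  digits \<open>v\<close> into the others. Keeping the whole leading part of \<open>a\<close> at \<open>m = 0\<close> makes the map strictly
  increasing on all integers.
\<close>

primrec spread :: "int \<Rightarrow> (nat \<Rightarrow> bool) \<Rightarrow> (nat \<Rightarrow> int) \<Rightarrow> nat \<Rightarrow> int \<Rightarrow> int" where
  "spread b fr v 0 a = a"
| "spread b fr v (Suc m) a =
     (if fr m then b * spread b fr v m (a div b) + a mod b else b * spread b fr v m a + v m)"

text \<open>Digits are compared lexicographically. If the leading parts \<open>a div b\<close>
  agree, the last digit decides; otherwise the image of the leading part grows by at least 1, and
  after multiplication by \<open>b\<close> this outweighs any difference of last digits.\<close>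

lemma spread_strict_mono:
  assumes "0 < b" "a < a'"
  shows "spread b fr v m a < spread b fr v m a'"
  using assms(2)
proof (induction m arbitrary: a a')
  case 0
  then show ?case by simp
next
  case (Suc m)
  show ?case
  proof (cases "fr m")
    case True
    have le: "a div b \<le> a' div b"
      using Suc.prems \<open>0 < b\<close> by (simp add: zdiv_mono1)
    show ?thesis
    proof (cases "a div b = a' div b")
      case True
      then have "a mod b < a' mod b"
        using Suc.prems by (metis add_less_cancel_left mult_div_mod_eq)
      with True \<open>fr m\<close> show ?thesis by simp
    next
      case False
      then have "spread b fr v m (a div b) + 1 \<le> spread b fr v m (a' div b)"
        using Suc.IH[of "a div b" "a' div b"] le by simp
      then have "b * (spread b fr v m (a div b) + 1) \<le> b * spread b fr v m (a' div b)"
        using \<open>0 < b\<close> by simp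
      moreover have "a mod b < b" "0 \<le> a' mod b"
        using \<open>0 < b\<close> by auto
      ultimately show ?thesis using \<open>fr m\<close> by (simp add: algebra_simps)
    qed
  next
    case False
    then show ?thesis using Suc \<open>0 < b\<close> by simp
  qed
qed

text \<open>A strictly increasing map on the integers never shrinks gaps. This is the source of the
  expansion property of the maps into the level sets.\<close>

lemma spread_add_le:
  assumes "0 < b" "a + int k \<le> a'"
  shows "spread b fr v m a + int k \<le> spread b fr v m a'"
  using assms(2)
proof (induction k arbitrary: a')
  case 0
  then show ?case
    using spread_strict_mono[OF assms(1), of a a' fr v m] by (cases "a = a'") auto
next
  case (Suc k)
  from Suc.IH[of "a' - 1"] Suc.prems spread_strict_mono[OF assms(1), of "a' - 1" a' fr v m]
  show ?case by simp
qed

text \<open>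
  \<open>T m\<close> is the integer formed by the digits before position \<open>m\<close> of a base \<open>b\<close> expansion; the digit at
  position \<open>m\<close> is \<open>T (m + 1) - b T m\<close>. Expansions ending in \<open>b - 1\<close> repeated are not excluded.
\<close>

definition badic_prefix :: "nat \<Rightarrow> (nat \<Rightarrow> int) \<Rightarrow> bool" where
  "badic_prefix b T \<longleftrightarrow> (\<forall>m. int b * T m \<le> T (Suc m) \<and> T (Suc m) < int b * (T m + 1))"

text \<open>The cardinality is the number of digits of \<open>y\<close> consumed before position
  \<open>m\<close>. Dropping the last digit of \<open>\<lfloor>b^(k+1) y\<rfloor>\<close> leaves
  \<open>\<lfloor>b^k y\<rfloor>\<close>, so consecutive values of \<open>m\<close> give compatible
  prefixes.\<close>

lemma badic_prefix_spread:
  fixes y :: real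
  assumes "0 < b" "\<And>m. 0 \<le> v m \<and> v m < int b"
  shows "badic_prefix b (\<lambda>m. spread (int b) fr v m \<lfloor>real b ^ card {j. j < m \<and> fr j} * y\<rfloor>)"
    and "\<not> fr m \<Longrightarrow> spread (int b) fr v (Suc m) \<lfloor>real b ^ card {j. j < Suc m \<and> fr j} * y\<rfloor>
            = int b * spread (int b) fr v m \<lfloor>real b ^ card {j. j < m \<and> fr j} * y\<rfloor> + v m"
proof -
  define F where "F m = card {j. j < m \<and> fr j}" for m
  have F: "F (Suc m) = (if fr m then Suc (F m) else F m)" for m
  proof -
    have "{j. j < Suc m \<and> fr j} = (if fr m then insert m {j. j < m \<and> fr j} else {j. j < m \<and> fr j})"
      by (auto simp: less_Suc_eq)
    then show ?thesis by (simp add: F_def)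
  qed
  define A where "A k = \<lfloor>real b ^ k * y\<rfloor>" for k
  have fl: "A (Suc k) div int b = A k" for k
    using floor_divide_real_eq_div[of "int b" "real b ^ Suc k * y"] \<open>0 < b\<close> by (simp add: A_def)
  have "int b * spread (int b) fr v m (A (F m)) \<le> spread (int b) fr v (Suc m) (A (F (Suc m)))"
    and "spread (int b) fr v (Suc m) (A (F (Suc m))) < int b * (spread (int b) fr v m (A (F m)) + 1)" for m
    using assms(2)[of m] \<open>0 < b\<close> fl[of "F m"] by (auto simp: F distrib_left)
  then show "badic_prefix b (\<lambda>m. spread (int b) fr v m \<lfloor>real b ^ card {j. j < m \<and> fr j} * y\<rfloor>)"
    unfolding badic_prefix_def F_def A_def by blast
  show "spread (int b) fr v (Suc m) \<lfloor>real b ^ card {j. j < Suc m \<and> fr j} * y\<rfloor>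
            = int b * spread (int b) fr v m \<lfloor>real b ^ card {j. j < m \<and> fr j} * y\<rfloor> + v m"
    if "\<not> fr m"
    using that by (simp add: F flip: F_def)
qed

lemma badic_prefix_add:
  assumes "badic_prefix b T"
  shows "int b ^ k * T m \<le> T (m + k)" and "T (m + k) + 1 \<le> int b ^ k * (T m + 1)"
proof -
  have *: "int b * T m \<le> T (Suc m)" "T (Suc m) + 1 \<le> int b * (T m + 1)" for m
    using assms by (simp_all add: badic_prefix_def zless_imp_add1_zle)
  show "int b ^ k * T m \<le> T (m + k)"
  proof (induction k)
    case (Suc k)
    then have "int b * (int b ^ k * T m) \<le> int b * T (m + k)" by (intro mult_left_mono) auto
    with *(1)[of "m + k"] show ?case by (simp add: mult.assoc)
  qed simp
  show "T (m + k) + 1 \<le> int b ^ k * (T m + 1)"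
  proof (induction k)
    case (Suc k)
    then have "int b * (T (m + k) + 1) \<le> int b * (int b ^ k * (T m + 1))" by (intro mult_left_mono) auto
    with *(2)[of "m + k"] show ?case by (simp add: mult.assoc)
  qed simp
qed

text \<open>The closed intervals from \<open>T m / b^m\<close> to \<open>(T m + 1) / b^m\<close> are
  nested; the supremum of the left ends lies in all of them. The right ends have to be included
  because of tails of digits \<open>b - 1\<close>.\<close>

lemma badic_prefix_limit:
  assumes "badic_prefix b T" "0 < b"
  shows "\<exists>x::real. \<forall>m. T m \<le> real b ^ m * x \<and> real b ^ m * x \<le> real_of_int (T m) + 1"
proof -
  have le: "T k / real b ^ k \<le> (T m + 1) / real b ^ m" for k m
  proof (cases "k \<le> m")
    case True
    then have "int b ^ (m - k) * T k \<le> T m + 1"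
      using badic_prefix_add(1)[OF assms(1), where m=k and k="m-k"] by simp
    then have "real_of_int (int b ^ (m - k) * T k) \<le> real_of_int (T m + 1)"
      by (simp only: of_int_le_iff)
    then have "real b ^ (m - k) * T k \<le> T m + 1" by simp
    moreover have "real b ^ m = real b ^ (m - k) * real b ^ k"
      using True by (simp flip: power_add)
    ultimately show ?thesis using \<open>0 < b\<close> by (simp add: field_simps)
  next
    case False
    then have "T k \<le> int b ^ (k - m) * (T m + 1)"
      using badic_prefix_add(2)[OF assms(1), where m=m and k="k-m"] by simp
    then have "real_of_int (T k) \<le> real_of_int (int b ^ (k - m) * (T m + 1))"
      by (simp only: of_int_le_iff)
    then have "T k \<le> real b ^ (k - m) * (T m + 1)" by simp
    moreover have "real b ^ k = real b ^ (k - m) * real b ^ m"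
      using False by (simp flip: power_add)
    ultimately show ?thesis using \<open>0 < b\<close> by (simp add: field_simps)
  qed
  define x where "x = (SUP k. T k / real b ^ k)"
  have bdd: "bdd_above (range (\<lambda>k. T k / real b ^ k))"
    using le[of _ 0] by (intro bdd_aboveI2) auto
  have "T m / real b ^ m \<le> x" for m
    unfolding x_def by (intro cSUP_upper bdd) auto
  moreover have "x \<le> (T m + 1) / real b ^ m" for m
    unfolding x_def by (intro cSUP_least le) auto
  ultimately show ?thesis using \<open>0 < b\<close> by (intro exI[of _ x]) (auto simp: field_simps)
qed

text \<open>The hypotheses say that the digit at \<open>i\<close> is nonzero and the digit at
  \<open>j\<close> is below \<open>b - 1\<close>. The first keeps \<open>x\<close> away from
  \<open>T N / b^N\<close>, the second from \<open>(T N + 1) / b^N\<close>, each by one unit of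
  position \<open>J\<close>; every other \<open>p / b^N\<close> is farther away.\<close>

lemma badic_prefix_unapproximable:
  fixes x :: real and p :: int
  assumes T: "badic_prefix b T" and "0 < b"
    and x: "\<And>m. T m \<le> real b ^ m * x" "\<And>m. real b ^ m * x \<le> real_of_int (T m) + 1"
    and i: "N \<le> i" "i < J" "int b * T i < T (Suc i)"
    and j: "N \<le> j" "j < J" "T (Suc j) + 1 < int b * (T j + 1)"
  shows "1 / real b ^ J \<le> \<bar>x - p / real b ^ N\<bar>"
proof -
  have "N < J" using i by simp
  have TN: "int b ^ (J - N) * T N + 1 \<le> T J"
  proof -
    have "int b ^ Suc (i - N) * T N + 1 \<le> int b * T i + 1"
      using badic_prefix_add(1)[OF T, where k="i-N" and m=N] i \<open>0 < b\<close> by (simp add: mult.assoc)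
    also have "\<dots> \<le> T (Suc i)" using i by simp
    finally have "int b ^ (J - Suc i) * (int b ^ Suc (i - N) * T N + 1) \<le> int b ^ (J - Suc i) * T (Suc i)"
      using \<open>0 < b\<close> by (intro mult_left_mono) auto
    also have "\<dots> \<le> T J" using badic_prefix_add(1)[OF T, where k="J - Suc i" and m="Suc i"] i by simp
    also have "int b ^ (J - Suc i) * (int b ^ Suc (i - N) * T N + 1) = int b ^ (J - N) * T N + int b ^ (J - Suc i)"
    proof -
      have "J - N = J - Suc i + Suc (i - N)" using i by simp
      then show ?thesis by (simp only: power_add distrib_left mult.assoc mult_1_right)
    qed
    finally show ?thesis using \<open>0 < b\<close>
      by (smt (verit) of_nat_0_less_iff zero_less_power)
  qed
  \<comment> \<open>Two units are required here, against one on the left: \<open>x\<close> may reach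
    the right end \<open>T J + 1\<close> of its interval, and a further unit of distance has to
    remain.\<close>
  have TN': "T J + 2 \<le> int b ^ (J - N) * (T N + 1)"
  proof -
    have "T (Suc j) + 2 \<le> int b * (T j + 1)" using j by simp
    also have "\<dots> \<le> int b ^ Suc (j - N) * (T N + 1)"
      using badic_prefix_add(2)[OF T, where k="j-N" and m=N] j \<open>0 < b\<close> by (simp add: mult.assoc)
    finally have "int b ^ (J - Suc j) * (T (Suc j) + 2) \<le> int b ^ (J - Suc j) * (int b ^ Suc (j - N) * (T N + 1))"
      using \<open>0 < b\<close> by (intro mult_left_mono) auto
    also have "\<dots> = int b ^ (J - N) * (T N + 1)"
    proof -
      have "J - N = J - Suc j + Suc (j - N)" using j by simp
      then show ?thesis by (simp only: power_add mult.assoc)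
    qed
    finally have "int b ^ (J - Suc j) * (T (Suc j) + 1) + int b ^ (J - Suc j) \<le> int b ^ (J - N) * (T N + 1)"
      by (simp add: algebra_simps)
    moreover have "T J + 1 \<le> int b ^ (J - Suc j) * (T (Suc j) + 1)"
      using badic_prefix_add(2)[OF T, where k="J - Suc j" and m="Suc j"] j by simp
    moreover have "1 \<le> int b ^ (J - Suc j)" using \<open>0 < b\<close> by simp
    ultimately show ?thesis by linarith
  qed
  have pw: "real b ^ J = real b ^ (J - N) * real b ^ N"
    using \<open>N < J\<close> by (simp flip: power_add)
  have x_lo: "real b ^ (J - N) * T N + 1 \<le> real b ^ J * x"
  proof -
    have "real_of_int (int b ^ (J - N) * T N + 1) \<le> real_of_int (T J)" using TN
      by (simp only: of_int_le_iff)
    then have "real b ^ (J - N) * T N + 1 \<le> T J" by simp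
    then show ?thesis using x(1)[of J] by linarith
  qed
  have x_hi: "real b ^ J * x + 1 \<le> real b ^ (J - N) * (T N + 1)"
  proof -
    have "real_of_int (T J + 2) \<le> real_of_int (int b ^ (J - N) * (T N + 1))" using TN'
      by (simp only: of_int_le_iff)
    then have "T J + 2 \<le> real b ^ (J - N) * (T N + 1)" by simp
    then show ?thesis using x(2)[of J] by linarith
  qed
  have "1 \<le> \<bar>real b ^ J * x - real b ^ (J - N) * p\<bar>"
  proof (cases "p \<le> T N")
    case True
    then have "real b ^ (J - N) * p \<le> real b ^ (J - N) * T N" by (intro mult_left_mono) auto
    then show ?thesis using x_lo by linarith
  next
    case False
    then have "real_of_int (T N + 1) \<le> p" by linarith
    then have "real b ^ (J - N) * (T N + 1) \<le> real b ^ (J - N) * p" by (intro mult_left_mono) auto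
    then show ?thesis using x_hi by linarith
  qed
  also have "real b ^ J * x - real b ^ (J - N) * p = real b ^ J * (x - p / real b ^ N)"
    using \<open>0 < b\<close> by (simp add: pw field_simps)
  also have "\<bar>\<dots>\<bar> = real b ^ J * \<bar>x - p / real b ^ N\<bar>" by (simp add: abs_mult)
  finally show ?thesis using \<open>0 < b\<close> by (simp add: field_simps)
qed

lemma badic_prefix_zero_run:
  assumes T: "\<And>j. N \<le> j \<Longrightarrow> j < N + k \<Longrightarrow> T (Suc j) = int b * T j"
  shows "T (N + k) = int b ^ k * T N"
  using assms by (induction k) (auto simp: mult.assoc)

subsection \<open>Reals with a given exponent\<close>

text \<open>The ratio of consecutive starts is \<open>(k + 1)^3\<close>. A block extends its start
  by a factor of at most \<open>k\<close>, so a factor \<open>(k + 1)^2\<close> is left between the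
  end of a block and the next start.\<close>

definition block_start :: "nat \<Rightarrow> nat" where
  "block_start k = fact k ^ 3"

text \<open>Truncating \<open>l\<close> at \<open>k\<close> treats \<open>l = \<infinity>\<close> like the finite exponents.\<close>

definition block_end :: "ereal \<Rightarrow> nat \<Rightarrow> nat" where
  "block_end l k = nat \<lceil>real_of_ereal (min l (ereal k)) * block_start k\<rceil>"

definition blocked :: "ereal \<Rightarrow> nat set \<Rightarrow> nat \<Rightarrow> bool" where
  "blocked l K j \<longleftrightarrow> (\<exists>k\<in>K. block_start k \<le> j \<and> j < block_end l k)"

definition free_position :: "ereal \<Rightarrow> nat set \<Rightarrow> nat \<Rightarrow> bool" where
  "free_position l K j \<longleftrightarrow> \<not> blocked l K j \<and> \<not> double_square j"

text \<open>Parity yields the digit 0 at \<open>2 * q\<^sup>2\<close> and 1 at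
  \<open>2 * q\<^sup>2 + 1\<close>; inside a block the zero takes precedence.\<close>

definition forced_digit :: "ereal \<Rightarrow> nat set \<Rightarrow> nat \<Rightarrow> int" where
  "forced_digit l K j = (if blocked l K j then 0 else int (j mod 2))"

section \<open>Growth and separation of the blocks\<close>

lemma block_start_Suc: "block_start (Suc k) = Suc k ^ 3 * block_start k"
  by (simp only: block_start_def fact_Suc power_mult_distrib of_nat_id)

lemma block_start_mono: "k \<le> k' \<Longrightarrow> block_start k \<le> block_start k'"
  unfolding block_start_def by (intro power_mono fact_mono) auto

lemma le_block_start: "k \<le> block_start k"
  unfolding block_start_def using fact_ge_self[of k] self_le_power[of "fact k" 3]
  by (metis fact_ge_1 order.trans zero_less_numeral)

text \<open>The third part is what makes the truncation harmless: every real
  \<open>\<mu> \<le> l\<close> is reached as soon as \<open>k \<ge> \<mu>\<close>, also when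
  \<open>l\<close> is infinite.\<close>

lemma block_factor:
  assumes "1 \<le> l"
  shows "real_of_ereal (min l (ereal (real k))) \<le> k"
    and "1 \<le> k \<Longrightarrow> 1 \<le> real_of_ereal (min l (ereal (real k)))"
    and "ereal \<mu> \<le> l \<Longrightarrow> \<mu> \<le> k \<Longrightarrow> \<mu> \<le> real_of_ereal (min l (ereal (real k)))"
    and "0 \<le> real_of_ereal (min l (ereal (real k)))"
  using assms by (cases l; auto simp: min_def)+

lemma block_end_le:
  assumes "1 \<le> l"
  shows "block_end l k \<le> k * block_start k"
proof -
  have "real_of_ereal (min l (ereal k)) * block_start k \<le> real k * block_start k"
    using block_factor(1)[OF assms] by (intro mult_right_mono) auto
  then have "\<lceil>real_of_ereal (min l (ereal k)) * block_start k\<rceil> \<le> int (k * block_start k)"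
    by (simp add: ceiling_le_iff)
  then show ?thesis unfolding block_end_def by linarith
qed

lemma block_end_ge: "real_of_ereal (min l (ereal k)) * block_start k \<le> block_end l k"
  unfolding block_end_def by linarith

lemma block_end_le_real:
  fixes r :: real
  assumes "1 \<le> r"
  shows "block_end (ereal r) k \<le> r * block_start k + 1"
proof -
  have "real_of_ereal (min (ereal r) (ereal k)) * block_start k \<le> r * block_start k"
    by (intro mult_right_mono) (auto simp: min_def)
  moreover have "0 \<le> real_of_ereal (min (ereal r) (ereal k)) * block_start k"
    using block_factor(4)[of "ereal r" k] assms by simp
  ultimately show ?thesis unfolding block_end_def by linarith
qed

lemma block_start_le_end:
  assumes "1 \<le> l" "1 \<le> k"
  shows "block_start k \<le> block_end l k"
proof -
  have "1 * real (block_start k) \<le> real_of_ereal (min l (ereal k)) * block_start k"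
    using block_factor(2)[OF assms] by (intro mult_right_mono) auto
  then have "real (block_start k) \<le> block_end l k" using block_end_ge[of l k] by linarith
  then show ?thesis by simp
qed

text \<open>This separates consecutive blocks and, more strongly, makes everything up to the end of
  one block a vanishing proportion of the next scale.\<close>

lemma block_end_Suc_le:
  assumes "1 \<le> l"
  shows "(Suc k)\<^sup>2 * block_end l k \<le> block_start (Suc k)"
proof -
  have "(Suc k)\<^sup>2 * block_end l k \<le> (Suc k)\<^sup>2 * (Suc k * block_start k)"
    using block_end_le[OF assms, of k] by (intro mult_left_mono) (auto intro: trans_le_add2)
  also have "\<dots> = block_start (Suc k)"
    by (simp only: block_start_Suc power3_eq_cube power2_eq_square mult.assoc)
  finally show ?thesis .
qed

lemma block_end_mono:
  assumes "1 \<le> l" "k \<le> k'"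
  shows "block_end l k \<le> block_end l k'"
proof (cases "k = k'")
  case False
  then have k: "Suc k \<le> k'" using assms by simp
  have "block_end l k \<le> (Suc k)\<^sup>2 * block_end l k" by simp
  also have "\<dots> \<le> block_start (Suc k)" by (rule block_end_Suc_le[OF assms(1)])
  also have "\<dots> \<le> block_start k'" using k by (rule block_start_mono)
  also have "\<dots> \<le> block_end l k'" using k assms by (intro block_start_le_end) auto
  finally show ?thesis .
qed simp

lemma not_blocked_between:
  assumes "1 \<le> l" "block_end l k \<le> j" "j < block_start (Suc k)"
  shows "\<not> blocked l K j"
proof
  assume "blocked l K j"
  then obtain k' where k': "block_start k' \<le> j" "j < block_end l k'" by (auto simp: blocked_def)
  show False
  proof (cases "k' \<le> k")
    case True
    then show ?thesis using block_end_mono[OF assms(1) True] k' assms by linarith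
  next
    case False
    then show ?thesis using block_start_mono[of "Suc k" k'] k' assms by linarith
  qed
qed

text \<open>The bound \<open>\<rho> \<le> 2\<close> keeps the pair of positions below twice the end
  of the block, hence before the next block starts.\<close>

lemma unblocked_double_square_after_block:
  fixes \<rho> :: real
  assumes "1 \<le> l" "1 < \<rho>" "\<rho> \<le> 2"
  shows "\<exists>M. \<forall>k. M \<le> block_end l k \<longrightarrow>
    (\<exists>q. block_end l k \<le> 2 * q\<^sup>2 \<and> real (2 * q\<^sup>2 + 2) \<le> \<rho> * block_end l k \<and> \<not> blocked l K (2 * q\<^sup>2 + 1))"
proof -
  obtain M where M: "\<And>N. N \<ge> M \<Longrightarrow> \<exists>q. N \<le> 2 * q\<^sup>2 \<and> real (2 * q\<^sup>2 + 2) \<le> \<rho> * real N"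
    using double_square_dense[OF assms(2)] by blast
  have "\<exists>q. block_end l k \<le> 2 * q\<^sup>2 \<and> real (2 * q\<^sup>2 + 2) \<le> \<rho> * block_end l k \<and> \<not> blocked l K (2 * q\<^sup>2 + 1)"
    if k: "M \<le> block_end l k" for k
  proof -
    obtain q where q: "block_end l k \<le> 2 * q\<^sup>2" "real (2 * q\<^sup>2 + 2) \<le> \<rho> * block_end l k"
      using M[OF k] by blast
    have "\<rho> * block_end l k \<le> 2 * real (block_end l k)" using assms by (intro mult_right_mono) auto
    then have le: "2 * q\<^sup>2 + 2 \<le> 2 * block_end l k" using q by linarith
    \<comment> \<open>Block 0 is empty: \<open>block_end l 0 = 0\<close>, which cannot bound the
      positive number \<open>2 * q\<^sup>2 + 2\<close>.\<close>
    then have "k \<noteq> 0" using block_end_le[OF assms(1), of k] by (auto intro!: Nat.gr0I)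
    then have "2 \<le> (Suc k)\<^sup>2" by (cases k) (auto simp: power2_eq_square)
    then have "2 * block_end l k \<le> (Suc k)\<^sup>2 * block_end l k" by (intro mult_right_mono) auto
    also have "\<dots> \<le> block_start (Suc k)" by (rule block_end_Suc_le[OF assms(1)])
    finally have "\<not> blocked l K (2 * q\<^sup>2 + 1)"
      using le q(1) by (intro not_blocked_between[OF assms(1), of k]) auto
    with q show ?thesis by blast
  qed
  then show ?thesis by blast
qed

text \<open>A block of zeros from \<open>N\<close> to \<open>E\<close> puts \<open>x\<close> within
  \<open>b^-E\<close> of \<open>T N / b^N\<close>, with \<open>E\<close> at least
  \<open>\<mu> * N\<close> for any given \<open>\<mu> < l\<close> once the block is late enough.
  Conversely, from any \<open>N\<close> a pair of digits \<open>0, 1\<close> is met before about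
  \<open>l * N\<close>: the next one, or the one behind the block that swallows it.\<close>

lemma badic_exponent_of_forced_digits:
  fixes x :: real
  assumes "2 \<le> b" "1 \<le> l" "infinite K"
    and T: "badic_prefix b T"
    and x: "\<And>m. T m \<le> real b ^ m * x" "\<And>m. real b ^ m * x \<le> real_of_int (T m) + 1"
    and forced: "\<And>j. \<not> free_position l K j \<Longrightarrow> T (Suc j) = int b * T j + forced_digit l K j"
  shows "badic_exponent b x = l"
proof (rule antisym)
  have b: "0 < b" "1 < real b" using \<open>2 \<le> b\<close> by auto
  \<comment> \<open>The digit at \<open>2 * q\<^sup>2\<close> is 0 whether or not the position is
    blocked, hence below \<open>b - 1\<close>. Only the digit 1 at the next position has to be
    outside the blocks.\<close>
  have gap: "1 / real b ^ (2 * q\<^sup>2 + 2) \<le> \<bar>x - p / real b ^ N\<bar>"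
    if "\<not> blocked l K (2 * q\<^sup>2 + 1)" "N \<le> 2 * q\<^sup>2" for q N and p :: int
  proof (rule badic_prefix_unapproximable[OF T b(1) x])
    have ds: "double_square (2 * q\<^sup>2)" "double_square (2 * q\<^sup>2 + 1)" by (auto simp: double_square_def)
    then show "int b * T (2 * q\<^sup>2 + 1) < T (Suc (2 * q\<^sup>2 + 1))"
      using forced[of "2 * q\<^sup>2 + 1"] that by (simp add: free_position_def forced_digit_def)
    show "T (Suc (2 * q\<^sup>2)) + 1 < int b * (T (2 * q\<^sup>2) + 1)"
      using forced[of "2 * q\<^sup>2"] ds \<open>2 \<le> b\<close> by (simp add: free_position_def forced_digit_def algebra_simps)
  qed (use that in auto)
  have powr: "(real b ^ N) powr (- \<mu>) = real b powr (- (\<mu> * N))" for N \<mu>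
    using b by (simp add: powr_realpow[symmetric] powr_powr mult.commute)
  have pow: "1 / real b ^ E = real b powr (- real E)" for E
    using b by (simp add: powr_minus powr_realpow divide_inverse)

  show "l \<le> badic_exponent b x"
  proof (rule dense_le)
    fix u assume "u < l"
    have "max u 0 < l" using \<open>u < l\<close> \<open>1 \<le> l\<close> by (auto simp: max_def intro: less_le_trans[of 0 1])
    then obtain \<mu> where \<mu>: "max u 0 < ereal \<mu>" "ereal \<mu> < l" using ereal_dense2 by blast
    have "ereal \<mu> \<le> badic_exponent b x"
    proof (rule badic_exponent_geI[OF \<open>2 \<le> b\<close>])
      show "0 < \<mu>" using \<mu> by simp
      fix M
      obtain M' where M': "\<And>k. M' \<le> block_end l k \<Longrightarrow> \<exists>q. block_end l k \<le> 2 * q\<^sup>2 \<and> \<not> blocked l K (2 * q\<^sup>2 + 1)"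
        using unblocked_double_square_after_block[OF \<open>1 \<le> l\<close>, of 2] by force
      \<comment> \<open>\<open>k\<close> exceeds \<open>\<mu>\<close>, so that the truncation at
        \<open>k\<close> does not push the factor of the block below \<open>\<mu>\<close>; it also
        exceeds \<open>M\<close> and \<open>M'\<close>.\<close>
      obtain k where k: "k \<in> K" "Suc (max (nat \<lceil>\<mu>\<rceil>) (max M M')) \<le> k"
        using \<open>infinite K\<close> unfolding infinite_nat_iff_unbounded_le by blast
      define N where "N = block_start k"
      define E where "E = block_end l k"
      have "k \<le> N" "N \<le> E" using k le_block_start block_start_le_end[OF \<open>1 \<le> l\<close>] by (auto simp: N_def E_def)
      have "T (N + (E - N)) = int b ^ (E - N) * T N"
      proof (rule badic_prefix_zero_run)
        fix j assume "N \<le> j" "j < N + (E - N)"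
        then have "blocked l K j" using k(1) by (auto simp: blocked_def N_def E_def)
        then show "T (Suc j) = int b * T j" using forced by (simp add: free_position_def forced_digit_def)
      qed
      then have TE: "T E = real b ^ (E - N) * T N" using \<open>N \<le> E\<close> by simp
      have bE: "real b ^ E = real b ^ (E - N) * real b ^ N" using \<open>N \<le> E\<close> by (simp flip: power_add)
      have "real b ^ E * x - real b ^ (E - N) * T N = real b ^ E * (x - T N / real b ^ N)"
        using b by (simp add: bE field_simps)
      moreover have "0 \<le> real b ^ E * x - real b ^ (E - N) * T N" "real b ^ E * x - real b ^ (E - N) * T N \<le> 1"
        using x[of E] by (simp_all add: TE)
      ultimately have "\<bar>real b ^ E * (x - T N / real b ^ N)\<bar> \<le> 1" by simp
      then have "real b ^ E * \<bar>x - T N / real b ^ N\<bar> \<le> 1" by (simp add: abs_mult)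
      then have "\<bar>x - T N / real b ^ N\<bar> \<le> 1 / real b ^ E"
        using b by (simp add: pos_le_divide_eq mult.commute)
      also have "\<dots> \<le> (real b ^ N) powr (- \<mu>)"
      proof -
        have "\<mu> \<le> real_of_ereal (min l (ereal k))"
          using k(2) \<mu> by (intro block_factor(3) \<open>1 \<le> l\<close>) (auto intro: less_imp_le, linarith)
        then have "\<mu> * N \<le> real_of_ereal (min l (ereal k)) * N" by (intro mult_right_mono) auto
        then have "\<mu> * N \<le> E" using block_end_ge[of l k] by (simp add: N_def E_def)
        then show ?thesis unfolding powr pow using b by (intro powr_mono) auto
      qed
      finally have "\<bar>x - T N / real b ^ N\<bar> \<le> (real b ^ N) powr (- \<mu>)" .
      \<comment> \<open>The pair of digits behind the block bounds the distance from below, so the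
        approximant is not \<open>x\<close> itself.\<close>
      moreover have "T N / real b ^ N \<noteq> x"
      proof -
        obtain q where q: "E \<le> 2 * q\<^sup>2" "\<not> blocked l K (2 * q\<^sup>2 + 1)"
          using M'[of k] k(2) \<open>k \<le> N\<close> \<open>N \<le> E\<close> unfolding E_def
          by (meson Suc_leD max.boundedE order.trans)
        then have "1 / real b ^ (2 * q\<^sup>2 + 2) \<le> \<bar>x - T N / real b ^ N\<bar>"
          using \<open>N \<le> E\<close> by (intro gap) auto
        moreover have "0 < 1 / real b ^ (2 * q\<^sup>2 + 2)" using b by simp
        ultimately show ?thesis by linarith
      qed
      moreover have "M \<le> N" using k \<open>k \<le> N\<close> by simp
      ultimately show "\<exists>N\<ge>M. \<exists>p::int. p / real b ^ N \<noteq> x \<and> \<bar>x - p / real b ^ N\<bar> \<le> (real b ^ N) powr (- \<mu>)"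
        by blast
    qed
    then show "u \<le> badic_exponent b x" using \<mu>(1) by (meson less_imp_le max.strict_boundedE order.trans)
  qed

  show "badic_exponent b x \<le> l"
  proof (rule dense_ge)
    fix u assume "l < u"
    then obtain \<mu> where \<mu>: "l < ereal \<mu>" "ereal \<mu> < u" using ereal_dense2 by blast
    then obtain r where r: "l = ereal r" "1 \<le> r" "r < \<mu>" using \<open>1 \<le> l\<close> by (cases l) auto
    \<comment> \<open>Since \<open>r * \<rho>\<^sup>2 < \<mu>\<close>, two factors
      \<open>\<rho>\<close> are affordable: one for the way from \<open>N\<close> to the next pair,
      one for the way from the end of a block to the pair behind it.\<close>
    have "1 < min (sqrt (\<mu> / r)) 2" using r by (auto simp: field_simps)
    then obtain \<rho> where \<rho>: "1 < \<rho>" "\<rho> < min (sqrt (\<mu> / r)) 2" using dense by blast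
    have "\<rho>\<^sup>2 < (sqrt (\<mu> / r))\<^sup>2" using \<rho> by (intro power_strict_mono) auto
    then have \<rho>2: "r * \<rho>\<^sup>2 < \<mu>" using r by (simp add: field_simps)
    obtain M1 where M1: "\<And>N. N \<ge> M1 \<Longrightarrow> \<exists>q. N \<le> 2 * q\<^sup>2 \<and> real (2 * q\<^sup>2 + 2) \<le> \<rho> * real N"
      using double_square_dense[OF \<rho>(1)] by blast
    obtain M2 where M2: "\<And>k. M2 \<le> block_end l k \<Longrightarrow>
        \<exists>q. block_end l k \<le> 2 * q\<^sup>2 \<and> real (2 * q\<^sup>2 + 2) \<le> \<rho> * block_end l k \<and> \<not> blocked l K (2 * q\<^sup>2 + 1)"
      using unblocked_double_square_after_block[OF \<open>1 \<le> l\<close> \<rho>(1), of K] \<rho>(2) by auto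
    have "badic_exponent b x \<le> ereal \<mu>"
    proof (rule badic_exponent_leI[OF b(1), where M = "max 1 (max M1 M2)"])
      show "0 \<le> \<mu>" using r by simp
      fix N and p :: int
      assume N: "max 1 (max M1 M2) \<le> N"
      have "\<exists>q. N \<le> 2 * q\<^sup>2 \<and> real (2 * q\<^sup>2 + 2) \<le> r * \<rho>\<^sup>2 * N \<and> \<not> blocked l K (2 * q\<^sup>2 + 1)"
      proof -
        obtain q where q: "N \<le> 2 * q\<^sup>2" "real (2 * q\<^sup>2 + 2) \<le> \<rho> * real N" using M1[of N] N by auto
        have "\<rho> * 1 \<le> \<rho> * (r * \<rho>)" using \<rho> r
          by (intro mult_left_mono) (auto intro: order.trans[OF _ mult_mono[of 1 r 1 \<rho>]])
        then have "\<rho> \<le> r * \<rho>\<^sup>2" by (simp add: power2_eq_square mult_ac)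
        then have \<rho>N: "\<rho> * N \<le> r * \<rho>\<^sup>2 * N" by (intro mult_right_mono) auto
        show ?thesis
        proof (cases "blocked l K (2 * q\<^sup>2 + 1)")
          case False
          then show ?thesis using q \<rho>N by (intro exI[of _ q]) auto
        next
          case True
          \<comment> \<open>The pair is swallowed by block \<open>k\<close>, which starts no later
            than \<open>2 * q\<^sup>2 + 1\<close> and therefore ends at about \<open>r\<close> times
            that position; the pair behind its end is used instead.\<close>
          then obtain k where k: "block_start k \<le> 2 * q\<^sup>2 + 1" "2 * q\<^sup>2 + 1 < block_end l k"
            by (auto simp: blocked_def)
          then obtain q' where q': "block_end l k \<le> 2 * q'\<^sup>2" "real (2 * q'\<^sup>2 + 2) \<le> \<rho> * block_end l k"
             "\<not> blocked l K (2 * q'\<^sup>2 + 1)"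
            using M2[of k] N q by auto
          have "real (block_end l k) \<le> r * block_start k + 1"
            unfolding r using r by (intro block_end_le_real)
          \<comment> \<open>The 1 caused by rounding up the block end is at most \<open>r\<close>,
            which completes the factor to \<open>2 * q\<^sup>2 + 2\<close>, the quantity already
            bounded by \<open>\<rho> * N\<close>.\<close>
          also have "\<dots> \<le> r * real (2 * q\<^sup>2 + 1) + r"
            using k(1) r by (intro add_mono mult_left_mono of_nat_mono) auto
          also have "\<dots> = r * real (2 * q\<^sup>2 + 2)" by (simp add: algebra_simps)
          also have "\<dots> \<le> r * (\<rho> * N)" using q r by (intro mult_left_mono) auto
          finally have "\<rho> * block_end l k \<le> \<rho> * (r * (\<rho> * N))" using \<rho> by (intro mult_left_mono) auto
          also have "\<dots> = r * \<rho>\<^sup>2 * N" by (simp add: power2_eq_square)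
          finally show ?thesis using q' q k by (intro exI[of _ q']) auto
        qed
      qed
      then obtain q where q: "N \<le> 2 * q\<^sup>2" "real (2 * q\<^sup>2 + 2) \<le> r * \<rho>\<^sup>2 * N" "\<not> blocked l K (2 * q\<^sup>2 + 1)"
        by blast
      have "r * \<rho>\<^sup>2 * N < \<mu> * N" using \<rho>2 N by (intro mult_strict_right_mono) auto
      then have "(real b ^ N) powr (- \<mu>) < 1 / real b ^ (2 * q\<^sup>2 + 2)"
        unfolding powr pow using b q by (intro powr_less_mono) auto
      also have "\<dots> \<le> \<bar>x - p / real b ^ N\<bar>" using q by (intro gap)
      finally show "(real b ^ N) powr (- \<mu>) < \<bar>x - p / real b ^ N\<bar>" .
    qed
    then show "badic_exponent b x \<le> u" using \<mu>(2) by (meson less_imp_le order.trans)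
  qed
qed

text \<open>The map \<open>g\<close> writes the digits of \<open>y\<close> into the free positions.
  Closeness of the values to within \<open>b^-m\<close> leaves the \<open>m\<close>-digit prefixes
  within one unit of each other, hence also the digits of \<open>y\<close> that were spread into
  them, as spreading does not shrink gaps.\<close>

lemma badic_exponent_expanding_map:
  assumes "2 \<le> b" "1 \<le> l" "infinite K"
  shows "\<exists>g. (\<forall>y. badic_exponent b (g y) = l) \<and> (\<forall>m y y'. \<bar>g y - g y'\<bar> < 1 / real b ^ m \<longrightarrow>
    \<bar>y - y'\<bar> < 2 / real b ^ card {j. j < m \<and> free_position l K j})"
proof -
  have b: "0 < b" using assms by simp
  let ?F = "\<lambda>m. card {j. j < m \<and> free_position l K j}"
  define S where "S m = spread (int b) (free_position l K) (forced_digit l K) m" for m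
  define T where "T y m = S m \<lfloor>real b ^ ?F m * y\<rfloor>" for y :: real and m
  have v: "0 \<le> forced_digit l K j \<and> forced_digit l K j < int b" for j
  proof -
    have "j mod 2 < b" using \<open>2 \<le> b\<close> by (meson less_le_trans mod_less_divisor pos2)
    then have "int (j mod 2) < int b" by (rule iffD2[OF of_nat_less_iff])
    then show ?thesis unfolding forced_digit_def using b by (simp split: if_split)
  qed
  have T: "badic_prefix b (T y)" for y
    unfolding T_def S_def using badic_prefix_spread(1)[OF b v] by simp
  have forced: "T y (Suc j) = int b * T y j + forced_digit l K j" if "\<not> free_position l K j" for y j
    unfolding T_def S_def using badic_prefix_spread(2)[where fr = "free_position l K" and v = "forced_digit l K", OF b v that] by simp
  have "\<exists>x::real. \<forall>m. T y m \<le> real b ^ m * x \<and> real b ^ m * x \<le> real_of_int (T y m) + 1" for y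
    by (rule badic_prefix_limit[OF T b])
  then have "\<forall>y. \<exists>x::real. \<forall>m. T y m \<le> real b ^ m * x \<and> real b ^ m * x \<le> real_of_int (T y m) + 1" by blast
  from choice[OF this] obtain g :: "real \<Rightarrow> real"
    where g: "\<And>y m. T y m \<le> real b ^ m * g y" "\<And>y m. real b ^ m * g y \<le> real_of_int (T y m) + 1"
    by blast
  \<comment> \<open>A gap of two units is needed because each prefix only locates its real in a
    closed interval of length one unit; two units between prefixes leave a full unit between the
    intervals.\<close>
  have sep: "1 / real b ^ m \<le> \<bar>g y - g y'\<bar>" if "2 / real b ^ ?F m \<le> y' - y" for m y y'
  proof -
    have "real b ^ ?F m * y + 2 \<le> real b ^ ?F m * y'"
      using that b by (simp add: field_simps)
    then have "\<lfloor>real b ^ ?F m * y\<rfloor> + int 2 \<le> \<lfloor>real b ^ ?F m * y'\<rfloor>" by linarith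
    then have "T y m + int 2 \<le> T y' m" unfolding T_def S_def using b by (intro spread_add_le) auto
    then have "1 \<le> real b ^ m * (g y' - g y)" using g(2)[of m y] g(1)[of y' m] by (simp add: right_diff_distrib)
    then have "1 / real b ^ m \<le> g y' - g y" using b by (simp add: field_simps)
    then show ?thesis by linarith
  qed
  show ?thesis
  proof (intro exI[of _ g] conjI allI impI)
    fix y
    show "badic_exponent b (g y) = l"
      by (rule badic_exponent_of_forced_digits[OF assms T g forced])
  next
    fix m y y' assume gap: "\<bar>g y - g y'\<bar> < 1 / real b ^ m"
    show "\<bar>y - y'\<bar> < 2 / real b ^ ?F m"
    proof (rule ccontr)
      assume "\<not> \<bar>y - y'\<bar> < 2 / real b ^ ?F m"
      then have "2 / real b ^ ?F m \<le> y' - y \<or> 2 / real b ^ ?F m \<le> y - y'" by linarith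
      then have "1 / real b ^ m \<le> \<bar>g y - g y'\<bar>"
        using sep[of m y y'] sep[of m y' y] by (auto simp: abs_minus_commute)
      with gap show False by simp
    qed
  qed
qed

text \<open>Three sources of loss: the earlier blocks all lie below the end of block
  \<open>k - 1\<close>, which is at most \<open>m / k\<^sup>2\<close>; the double squares number
  about \<open>2 * sqrt m\<close>; and block \<open>k\<close> itself counts if it is used. Later
  blocks start at or after \<open>m\<close>.\<close>

lemma card_not_free_le:
  assumes "1 \<le> l" "1 \<le> k" "block_start k \<le> m" "m \<le> block_start (Suc k)"
  shows "real (card {j. j < m \<and> \<not> free_position l K j})
    \<le> m / (real k)\<^sup>2 + 2 * sqrt m + 2 + (if k \<in> K then real (min (block_end l k) m - block_start k) else 0)"
proof -
  let ?B = "if k \<in> K then {block_start k..<min (block_end l k) m} else {}"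
  have "{j. j < m \<and> \<not> free_position l K j} \<subseteq> {..<block_end l (k - 1)} \<union> {j. j < m \<and> double_square j} \<union> ?B"
  proof (rule subsetI, rule ccontr)
    fix j assume "j \<in> {j. j < m \<and> \<not> free_position l K j}"
      and nin: "j \<notin> {..<block_end l (k - 1)} \<union> {j. j < m \<and> double_square j} \<union> ?B"
    then have j: "j < m" "\<not> free_position l K j" "j \<notin> ?B" "\<not> double_square j" by auto
    then obtain k' where k': "k' \<in> K" "block_start k' \<le> j" "j < block_end l k'"
      by (auto simp: free_position_def blocked_def)
    have "\<not> Suc k \<le> k'" using block_start_mono[of "Suc k" k'] k' j assms by linarith
    moreover have "k' \<noteq> k" using k' j by auto
    ultimately have "block_end l k' \<le> block_end l (k - 1)" by (intro block_end_mono assms) auto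
    then show False using k' nin by simp
  qed
  then have "card {j. j < m \<and> \<not> free_position l K j} \<le> card ({..<block_end l (k - 1)} \<union> {j. j < m \<and> double_square j} \<union> ?B)"
    by (intro card_mono) auto
  also have "\<dots> \<le> block_end l (k - 1) + card {j. j < m \<and> double_square j} + card ?B"
    by (intro order.trans[OF card_Un_le] add_mono) auto
  finally have "real (card {j. j < m \<and> \<not> free_position l K j}) \<le> real (block_end l (k - 1) + card {j. j < m \<and> double_square j} + card ?B)"
    by (rule of_nat_mono)
  moreover have "k\<^sup>2 * block_end l (k - 1) \<le> m"
    using block_end_Suc_le[OF assms(1), of "k - 1"] assms by simp
  then have "(real k)\<^sup>2 * block_end l (k - 1) \<le> m"
    by (metis of_nat_le_iff of_nat_mult of_nat_power)
  then have "block_end l (k - 1) \<le> m / (real k)\<^sup>2" using assms(2) by (simp add: field_simps)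
  moreover have "real (card ?B) = (if k \<in> K then real (min (block_end l k) m - block_start k) else 0)" by simp
  ultimately show ?thesis using card_double_square_less[of m] by simp
qed

text \<open>A block of exponent \<open>l\<close> that reaches up to \<open>e\<close> starts at about
  \<open>e / l\<close>, so it takes a proportion of at most \<open>1 - 1 / l\<close>, up to
  rounding. For infinite \<open>l\<close> the reciprocal is 0 and the bound is trivial.\<close>

lemma block_length_le:
  assumes "1 \<le> l"
  shows "real (min (block_end l k) m - block_start k) \<le> m * (1 - real_of_ereal (1 / l)) + 1"
proof (cases l)
  case (real r)
  then have "1 \<le> r" using assms by simp
  define e where "e = min (block_end l k) m"
  have "e \<le> r * block_start k + 1"
    using block_end_le_real[OF \<open>1 \<le> r\<close>, of k] by (simp add: e_def real)
  then have "e / r \<le> block_start k + 1 / r" using \<open>1 \<le> r\<close> by (simp add: field_simps)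
  moreover have "1 / r \<le> 1" using \<open>1 \<le> r\<close> by simp
  ultimately have "real e - block_start k \<le> e * (1 - 1 / r) + 1" by (simp add: algebra_simps)
  also have "\<dots> \<le> m * (1 - 1 / r) + 1" using \<open>1 \<le> r\<close> by (intro add_mono mult_right_mono) (auto simp: e_def)
  finally have "real e - block_start k \<le> m * (1 - 1 / r) + 1" .
  moreover have "0 \<le> m * (1 - 1 / r) + 1" using \<open>1 \<le> r\<close> by (intro add_nonneg_nonneg mult_nonneg_nonneg) auto
  moreover have "real_of_ereal (1 / l) = 1 / r"
    using \<open>1 \<le> r\<close> by (simp add: real divide_ereal_def divide_inverse)
  ultimately show ?thesis unfolding e_def[symmetric] by (simp add: of_nat_diff_if)
qed (use assms in auto)

subsection \<open>Upper bounds for the dimensions\<close>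

lemma hausdorff_dim_leI:
  assumes "\<And>s. 0 \<le> s \<Longrightarrow> d < ereal s \<Longrightarrow> hausdorff_measure s A = 0" "0 \<le> d"
  shows "hausdorff_dim A \<le> d"
proof (rule dense_ge)
  fix u assume "d < u"
  then obtain s where "d < ereal s" "ereal s < u" using ereal_dense2 by blast
  moreover from this have "0 \<le> s" using assms(2) by (metis ereal_less_eq(5) less_imp_le order.trans)
  ultimately show "hausdorff_dim A \<le> u"
    unfolding hausdorff_dim_def using assms(1)
    by (intro Inf_lower2[of "ereal s"]) auto
qed

lemma hausdorff_dim_geI:
  assumes "\<And>s. 0 \<le> s \<Longrightarrow> ereal s < d \<Longrightarrow> hausdorff_measure s A \<noteq> 0"
  shows "d \<le> hausdorff_dim A"
  unfolding hausdorff_dim_def using assms by (intro Inf_greatest) (force simp: not_less[symmetric])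

lemma packing_dim_leI:
  assumes "\<And>s. 0 \<le> s \<Longrightarrow> d < ereal s \<Longrightarrow> packing_measure s A = 0" "0 \<le> d"
  shows "packing_dim A \<le> d"
proof (rule dense_ge)
  fix u assume "d < u"
  then obtain s where "d < ereal s" "ereal s < u" using ereal_dense2 by blast
  moreover from this have "0 \<le> s" using assms(2) by (metis ereal_less_eq(5) less_imp_le order.trans)
  ultimately show "packing_dim A \<le> u"
    unfolding packing_dim_def using assms(1)
    by (intro Inf_lower2[of "ereal s"]) auto
qed

lemma packing_dim_geI:
  assumes "\<And>s. 0 \<le> s \<Longrightarrow> ereal s < d \<Longrightarrow> packing_measure s A \<noteq> 0"
  shows "d \<le> packing_dim A"
  unfolding packing_dim_def using assms by (intro Inf_greatest) (force simp: not_less[symmetric])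

section \<open>Covers and Hausdorff measure\<close>

lemma hausdorff_pre_measure_mono:
  "A \<subseteq> B \<Longrightarrow> hausdorff_pre_measure s \<delta> A \<le> hausdorff_pre_measure s \<delta> B"
  unfolding hausdorff_pre_measure_def by (intro INF_superset_mono) auto

lemma hausdorff_measure_mono: "A \<subseteq> B \<Longrightarrow> hausdorff_measure s A \<le> hausdorff_measure s B"
  unfolding hausdorff_measure_def by (intro SUP_mono') (rule hausdorff_pre_measure_mono)

text \<open>The usual argument with errors \<open>e / 2^(i+1)\<close>; \<open>prod_decode\<close>
  flattens the double sequence of covering sets.\<close>

lemma hausdorff_pre_measure_UN_le:
  "hausdorff_pre_measure s \<delta> (\<Union>i::nat. A i) \<le> (\<Sum>i. hausdorff_pre_measure s \<delta> (A i))"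
proof (cases "(\<Sum>i. hausdorff_pre_measure s \<delta> (A i)) = top")
  case False
  show ?thesis
  proof (rule ennreal_le_epsilon)
    fix e :: real assume "e > 0"
    have "\<exists>U. A i \<subseteq> (\<Union>j::nat. U j) \<and> (\<forall>j. bounded (U j) \<and> diameter (U j) \<le> \<delta>) \<and>
             (\<Sum>j. diam_power s (U j)) \<le> hausdorff_pre_measure s \<delta> (A i) + ennreal e * ennreal ((1/2) ^ Suc i)" for i
    proof -
      have "hausdorff_pre_measure s \<delta> (A i) < top"
        using False by (intro ennreal_suminf_lessD[of "\<lambda>i. hausdorff_pre_measure s \<delta> (A i)"]) (simp add: less_top)
      moreover have "0 < ennreal e * ennreal ((1/2) ^ Suc i)"
        using \<open>e > 0\<close> by (simp add: ennreal_zero_less_mult_iff)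
      ultimately have "hausdorff_pre_measure s \<delta> (A i) < hausdorff_pre_measure s \<delta> (A i) + ennreal e * ennreal ((1/2) ^ Suc i)"
        using ennreal_add_left_cancel_less[of "hausdorff_pre_measure s \<delta> (A i)" 0] by simp
      then show ?thesis
        unfolding hausdorff_pre_measure_def[of s \<delta> "A i"] INF_less_iff by (auto intro: less_imp_le)
    qed
    then have "\<forall>i. \<exists>U. A i \<subseteq> (\<Union>j::nat. U j) \<and> (\<forall>j. bounded (U j) \<and> diameter (U j) \<le> \<delta>) \<and>
             (\<Sum>j. diam_power s (U j)) \<le> hausdorff_pre_measure s \<delta> (A i) + ennreal e * ennreal ((1/2) ^ Suc i)"
      by blast
    from choice[OF this] obtain U where U: "\<And>i. A i \<subseteq> (\<Union>j::nat. U i j)"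
      "\<And>i j. bounded (U i j) \<and> diameter (U i j) \<le> \<delta>"
      "\<And>i. (\<Sum>j. diam_power s (U i j)) \<le> hausdorff_pre_measure s \<delta> (A i) + ennreal e * ennreal ((1/2) ^ Suc i)"
      by blast
    define V where "V n = case_prod U (prod_decode n)" for n
    have "(\<Union>i. A i) \<subseteq> (\<Union>n. V n)"
    proof clarify
      fix x i assume "x \<in> A i"
      then obtain j where "x \<in> U i j" using U(1) by blast
      then have "x \<in> V (prod_encode (i, j))" by (simp add: V_def)
      then show "x \<in> (\<Union>n. V n)" by blast
    qed
    moreover have "bounded (V n) \<and> diameter (V n) \<le> \<delta>" for n
      using U(2) by (simp add: V_def split: prod.split)
    ultimately have "hausdorff_pre_measure s \<delta> (\<Union>i. A i) \<le> (\<Sum>n. diam_power s (V n))"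
      unfolding hausdorff_pre_measure_def by (intro INF_lower) auto
    also have "\<dots> = (\<Sum>i. \<Sum>j. diam_power s (U i j))"
      using suminf_ennreal_2dimen[of "\<lambda>i. \<Sum>j. diam_power s (U i j)" "\<lambda>p. diam_power s (case_prod U p)"]
      by (simp add: V_def)
    also have "\<dots> \<le> (\<Sum>i. hausdorff_pre_measure s \<delta> (A i) + ennreal e * ennreal ((1/2) ^ Suc i))"
      by (intro suminf_le U) auto
    also have "\<dots> = (\<Sum>i. hausdorff_pre_measure s \<delta> (A i)) + ennreal e * (\<Sum>i. ennreal ((1/2) ^ Suc i))"
      by (simp add: suminf_add[symmetric] del: power_Suc)
    also have "\<dots> = (\<Sum>i. hausdorff_pre_measure s \<delta> (A i)) + ennreal e"
      by (subst suminf_ennreal_eq[OF _ power_half_series]) simp_all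
    finally show "hausdorff_pre_measure s \<delta> (\<Union>i. A i) \<le> (\<Sum>i. hausdorff_pre_measure s \<delta> (A i)) + ennreal e" .
  qed
qed simp

lemma hausdorff_pre_measure_finite_cover_le:
  assumes "finite I" "A \<subseteq> (\<Union>i\<in>I. U i)" "0 \<le> \<delta>" "\<delta> \<le> \<delta>'" "0 < s"
    and U: "\<And>i. i \<in> I \<Longrightarrow> bounded (U i)" "\<And>i. i \<in> I \<Longrightarrow> diameter (U i) \<le> \<delta>"
  shows "hausdorff_pre_measure s \<delta>' A \<le> ennreal (card I * \<delta> powr s)"
proof -
  obtain f where f: "bij_betw f {..<card I} I"
    using ex_bij_betw_nat_finite[OF \<open>finite I\<close>] by (auto simp: atLeast0LessThan)
  define V where "V n = (if n < card I then U (f n) else {})" for n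
  have fI: "n < card I \<Longrightarrow> f n \<in> I" for n using f by (auto simp: bij_betw_def)
  have "A \<subseteq> (\<Union>n. V n)"
  proof
    fix x assume "x \<in> A"
    then obtain i where i: "i \<in> I" "x \<in> U i" using assms by blast
    have "i \<in> f ` {..<card I}" using f i by (simp add: bij_betw_def)
    then obtain n where "n < card I" "f n = i" by auto
    then have "x \<in> V n" using i by (simp add: V_def)
    then show "x \<in> (\<Union>n. V n)" by blast
  qed
  moreover have "bounded (V n) \<and> diameter (V n) \<le> \<delta>'" for n
    using U[OF fI] assms by (force simp: V_def)
  ultimately have "hausdorff_pre_measure s \<delta>' A \<le> (\<Sum>n. diam_power s (V n))"
    unfolding hausdorff_pre_measure_def by (intro INF_lower) auto
  also have "\<dots> = (\<Sum>n<card I. diam_power s (V n))"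
    by (intro suminf_finite) (auto simp: V_def diam_power_def)
  also have "\<dots> \<le> (\<Sum>n<card I. ennreal (\<delta> powr s))"
  proof (intro sum_mono)
    fix n assume "n \<in> {..<card I}"
    then have "diameter (U (f n)) \<le> \<delta>" "bounded (U (f n))" using U fI by auto
    then show "diam_power s (V n) \<le> ennreal (\<delta> powr s)"
      using \<open>0 < s\<close> by (auto simp: V_def diam_power_def intro!: ennreal_leI powr_mono2 diameter_ge_0)
  qed
  also have "\<dots> = ennreal (card I * \<delta> powr s)"
    by (simp add: ennreal_mult ennreal_of_nat_eq_real_of_nat)
  finally show ?thesis .
qed

text \<open>A Borel-Cantelli argument: a point of norm at most \<open>R\<close> in this set lies in
  \<open>S R N\<close> for arbitrarily large \<open>N\<close>, so the levels from any
  \<open>M\<close> on cover, and their covering sums form the tail of a geometric series. Countably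
  many \<open>R\<close> exhaust the space.\<close>

lemma hausdorff_measure_badic_exponent_greater:
  fixes i :: "'a::euclidean_space"
  assumes "2 \<le> b" "i \<in> Basis" "0 < \<mu>" "real DIM('a) - 1 + 1 / \<mu> < s"
  shows "hausdorff_measure s {x. ereal \<mu> < badic_exponent b (x \<bullet> i)} = 0"
proof -
  define A where "A = {x. ereal \<mu> < badic_exponent b (x \<bullet> i)}"
  define d where "d = DIM('a)"
  define h where "h N = (real b ^ N) powr - \<mu>" for N
  define S where "S R N = {x::'a. norm x \<le> real R \<and> (\<exists>p::int. \<bar>x \<bullet> i - p / real b ^ N\<bar> \<le> h N)}" for R N
  have "1 \<le> d" unfolding d_def by (simp add: DIM_positive Suc_leI)
  have "0 < s" using assms(3,4) \<open>1 \<le> d\<close> by (smt (verit) d_def divide_pos_pos of_nat_1 of_nat_le_iff)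
  have b: "0 < b" "1 < real b" using assms by auto
  have h: "0 < h N" "h N \<le> 1" for N
  proof -
    show "0 < h N" using b by (simp add: h_def)
    have "h N \<le> (real b ^ N) powr 0" unfolding h_def using b assms by (intro powr_mono) auto
    then show "h N \<le> 1" using b by simp
  qed
  have cover: "hausdorff_pre_measure s \<delta> (S R N)
      \<le> ennreal (((2 * real R + 3) * real b ^ N) * ((2 * real R + 5) / h N) ^ (d - 1) * (2 * d * h N) powr s)"
    if "2 * d * h N \<le> \<delta>" for \<delta> R N
  proof -
    \<comment> \<open>\<open>P\<close> bounds the numerators, because \<open>x \<bullet> i\<close>
      is at most \<open>R\<close> in absolute value and \<open>h N \<le> 1\<close>; \<open>Q\<close>
      bounds the grid indices \<open>\<lfloor>x \<bullet> j / h N\<rfloor>\<close>.\<close>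
    define P where "P = int ((R + 1) * b ^ N)"
    define Q where "Q = \<lceil>R / h N\<rceil> + 1"
    define J where "J j = (if j = i then {- P..P} else {- Q..Q})" for j
    define I where "I = Pi\<^sub>E Basis J"
    define U where "U k = {x::'a. \<bar>x \<bullet> i - real_of_int (k i) / real b ^ N\<bar> \<le> h N \<and>
        (\<forall>j\<in>Basis - {i}. real_of_int (k j) * h N \<le> x \<bullet> j \<and> x \<bullet> j \<le> (real_of_int (k j) + 1) * h N)}" for k
    have dist: "dist x y \<le> 2 * d * h N" if "x \<in> U k" "y \<in> U k" for k x y
    proof -
      have "dist x y \<le> (\<Sum>j\<in>Basis. \<bar>(x - y) \<bullet> j\<bar>)" unfolding dist_norm by (rule norm_le_l1)
      also have "\<dots> \<le> (\<Sum>j\<in>(Basis::'a set). 2 * h N)"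
      proof (intro sum_mono)
        fix j :: 'a assume "j \<in> Basis"
        show "\<bar>(x - y) \<bullet> j\<bar> \<le> 2 * h N"
        proof (cases "j = i")
          case True
          then show ?thesis using that by (auto simp: U_def inner_diff_left)
        next
          case False
          then have "real_of_int (k j) * h N \<le> x \<bullet> j" "x \<bullet> j \<le> real_of_int (k j) * h N + h N"
            "real_of_int (k j) * h N \<le> y \<bullet> j" "y \<bullet> j \<le> real_of_int (k j) * h N + h N"
            using that \<open>j \<in> Basis\<close> by (auto simp: U_def algebra_simps)
          then show ?thesis using h[of N] by (simp add: inner_diff_left)
        qed
      qed
      finally show ?thesis by (simp add: d_def)
    qed
    have "hausdorff_pre_measure s \<delta> (S R N) \<le> ennreal (card I * (2 * d * h N) powr s)"
    proof (rule hausdorff_pre_measure_finite_cover_le[where U = U])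
      show "finite I" unfolding I_def by (intro finite_PiE) (auto simp: J_def)
      show "bounded (U k)" for k unfolding bounded_two_points using dist by blast
      show "diameter (U k) \<le> 2 * d * h N" for k
        using dist h(1)[of N] by (intro diameter_le) (auto simp: dist_norm)
      show "S R N \<subseteq> (\<Union>k\<in>I. U k)"
      proof
        fix x assume "x \<in> S R N"
        then obtain p :: int where x: "norm x \<le> R" and p: "\<bar>x \<bullet> i - p / real b ^ N\<bar> \<le> h N" by (auto simp: S_def)
        have xj: "\<bar>x \<bullet> j\<bar> \<le> R" if "j \<in> Basis" for j using Basis_le_norm[OF that, of x] x by linarith
        define k where "k = restrict (\<lambda>j. if j = i then p else \<lfloor>x \<bullet> j / h N\<rfloor>) Basis"
        have "\<bar>p / real b ^ N\<bar> \<le> R + 1" using p xj[OF assms(2)] h(2)[of N] by linarith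
        then have "\<bar>real_of_int p\<bar> \<le> (R + 1) * real b ^ N" using b by (simp add: field_simps)
        then have "\<bar>real_of_int p\<bar> \<le> real_of_int P" by (simp add: P_def algebra_simps)
        then have "p \<in> {- P..P}" by (simp only: of_int_abs[symmetric] of_int_le_iff) auto
        moreover have "\<lfloor>x \<bullet> j / h N\<rfloor> \<in> {- Q..Q}" if "j \<in> Basis" for j
        proof -
          have "\<bar>x \<bullet> j / h N\<bar> \<le> R / h N" using xj[OF that] h[of N] by (simp add: field_simps abs_divide)
          then show ?thesis unfolding Q_def atLeastAtMost_iff by linarith
        qed
        ultimately have "k \<in> I" by (auto simp: I_def k_def J_def)
        moreover have "x \<in> U k"
          unfolding U_def mem_Collect_eq
        proof (intro conjI ballI)
          show "\<bar>x \<bullet> i - real_of_int (k i) / real b ^ N\<bar> \<le> h N" using p assms(2) by (simp add: k_def)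
          fix j assume j: "j \<in> Basis - {i}"
          show "real_of_int (k j) * h N \<le> x \<bullet> j"
            using j floor_divide_lower[OF h(1), of "x \<bullet> j" N] by (simp add: k_def)
          show "x \<bullet> j \<le> (real_of_int (k j) + 1) * h N"
            using j floor_divide_upper[OF h(1), of "x \<bullet> j" N] by (simp add: k_def)
        qed
        ultimately show "x \<in> (\<Union>k\<in>I. U k)" by blast
      qed
    qed (use that h[of N] \<open>0 < s\<close> in auto)
    moreover have "real (card I) \<le> ((2 * real R + 3) * real b ^ N) * ((2 * real R + 5) / h N) ^ (d - 1)"
    proof -
      have "card I = (\<Prod>j\<in>Basis. card (J j))" unfolding I_def by (rule card_PiE) simp
      also have "\<dots> = card (J i) * (\<Prod>j\<in>Basis - {i}. card (J j))"
        using assms(2) by (simp add: prod.remove)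
      also have "(\<Prod>j\<in>Basis - {i}. card (J j)) = (\<Prod>j\<in>Basis - {i}. card {- Q..Q})"
        by (intro prod.cong) (auto simp: J_def)
      also have "\<dots> = card {- Q..Q} ^ (d - 1)"
        using assms(2) by (simp add: d_def)
      finally have "real (card I) = real (card (J i)) * real (card {- Q..Q}) ^ (d - 1)" by simp
      also have "\<dots> \<le> ((2 * real R + 3) * real b ^ N) * ((2 * real R + 5) / h N) ^ (d - 1)"
      proof (intro mult_mono power_mono)
        have "1 \<le> real b ^ N" using b by simp
        then show "real (card (J i)) \<le> (2 * real R + 3) * real b ^ N"
          by (simp add: J_def P_def algebra_simps)
        have "0 \<le> R / h N" "1 \<le> 1 / h N" using h[of N] by (auto simp: field_simps)
        then have "0 \<le> Q" "real_of_int Q \<le> R / h N + 2" unfolding Q_def by linarith+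
        then have "real (card {- Q..Q}) \<le> 2 * (R / h N) + 5" by simp
        also have "\<dots> \<le> 2 * (R / h N) + 5 * (1 / h N)" using \<open>1 \<le> 1 / h N\<close> by linarith
        also have "\<dots> = (2 * real R + 5) / h N" by (simp add: add_divide_distrib)
        finally show "real (card {- Q..Q}) \<le> (2 * real R + 5) / h N" .
      qed (use b in auto)
      finally show ?thesis .
    qed
    then have "ennreal (card I * (2 * d * h N) powr s)
       \<le> ennreal (((2 * real R + 3) * real b ^ N) * ((2 * real R + 5) / h N) ^ (d - 1) * (2 * d * h N) powr s)"
      by (intro ennreal_leI mult_right_mono) auto
    ultimately show ?thesis by (rule order.trans)
  qed
  \<comment> \<open>Level \<open>N\<close> uses about \<open>b^N * b^(\<mu> N (d-1))\<close> sets of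
    diameter of order \<open>b^(-\<mu> N)\<close>, so it contributes a multiple of
    \<open>b^(-\<eta> N)\<close>. The lower bound on \<open>s\<close>, multiplied by
    \<open>\<mu>\<close>, says that \<open>\<eta>\<close> is positive.\<close>
  define \<eta> where "\<eta> = \<mu> * s - 1 - \<mu> * (d - 1)"
  have "\<mu> * (real d - 1 + 1 / \<mu>) < \<mu> * s" using assms(3,4) unfolding d_def by (intro mult_strict_left_mono)
  then have "0 < \<eta>" using assms(3) \<open>1 \<le> d\<close> by (simp add: \<eta>_def algebra_simps of_nat_diff)
  define r where "r = real b powr - \<eta>"
  have r: "0 < r" "r < 1" using b \<open>0 < \<eta>\<close> by (auto simp: r_def powr_less_one)
  define c where "c R = (2 * real R + 3) * (2 * real R + 5) ^ (d - 1) * (2 * d) powr s" for R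
  have c: "0 \<le> c R" for R by (simp add: c_def)
  have cr: "((2 * real R + 3) * real b ^ N) * ((2 * real R + 5) / h N) ^ (d - 1) * (2 * d * h N) powr s = c R * r ^ N" for R N
  proof -
    have hN: "h N = real b powr - (\<mu> * N)"
      using b by (simp add: h_def powr_realpow[symmetric] powr_powr mult.commute)
    have "h N powr s = real b powr (- (\<mu> * N * s))" by (simp only: hN powr_powr) simp
    moreover have "1 / h N = real b powr (\<mu> * N)" using b by (simp add: hN powr_minus divide_inverse)
    then have "(1 / h N) ^ (d - 1) = real b powr (\<mu> * N * (d - 1))"
      using b by (simp only: powr_realpow[symmetric] powr_powr powr_gt_zero)
    ultimately have "real b ^ N * (1 / h N) ^ (d - 1) * h N powr s
        = real b powr N * real b powr (\<mu> * N * (d - 1)) * real b powr (- (\<mu> * N * s))"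
      using b by (simp only: powr_realpow)
    also have "\<dots> = real b powr (N + \<mu> * N * (d - 1) + - (\<mu> * N * s))"
      by (simp only: powr_add)
    also have "\<dots> = real b powr (- \<eta> * N)" by (simp add: \<eta>_def algebra_simps)
    also have "\<dots> = r powr N" by (simp add: r_def powr_powr)
    also have "\<dots> = r ^ N" using r(1) by (rule powr_realpow)
    finally have *: "real b ^ N * (1 / h N) ^ (d - 1) * h N powr s = r ^ N" .
    have "(2 * d * h N) powr s = (2 * d) powr s * h N powr s"
      using h[of N] by (simp add: powr_mult)
    moreover have "((2 * real R + 5) / h N) ^ (d - 1) = (2 * real R + 5) ^ (d - 1) * (1 / h N) ^ (d - 1)"
      by (simp add: power_divide)
    ultimately show ?thesis unfolding c_def *[symmetric] by (simp only: mult_ac)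
  qed
  have A_sub: "A \<inter> cball 0 R \<subseteq> (\<Union>N. S R (N + M))" for R M
  proof
    fix x assume "x \<in> A \<inter> cball 0 R"
    then obtain N and p :: int where "N \<ge> M" "\<bar>x \<bullet> i - p / real b ^ N\<bar> \<le> h N" "norm x \<le> R"
      using badic_approximations_of_less_exponent[of b \<mu> "x \<bullet> i" M] b assms(3) by (auto simp: A_def h_def)
    then have "x \<in> S R ((N - M) + M)" by (auto simp: S_def)
    then show "x \<in> (\<Union>N. S R (N + M))" by blast
  qed
  have h_lim: "h \<longlonglongrightarrow> 0"
  proof -
    have "(\<lambda>N. (real b powr - \<mu>) ^ N) \<longlonglongrightarrow> 0"
      using b assms(3) by (intro LIMSEQ_realpow_zero) (auto simp: powr_less_one)
    moreover have "h = (\<lambda>N. (real b powr - \<mu>) ^ N)"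
      using b by (intro ext) (simp add: h_def powr_realpow[symmetric] powr_powr mult.commute)
    ultimately show ?thesis by simp
  qed
  have null: "hausdorff_pre_measure s \<delta> (A \<inter> cball 0 (real R)) = 0" if "0 < \<delta>" for \<delta> R
  proof -
    have "(\<lambda>N. real (2 * d) * h N) \<longlonglongrightarrow> real (2 * d) * 0" by (intro tendsto_intros h_lim)
    then have "eventually (\<lambda>N. 2 * d * h N < \<delta>) sequentially"
      using that by (intro order_tendstoD(2)) auto
    then obtain M0 where M0: "\<And>N. N \<ge> M0 \<Longrightarrow> 2 * d * h N \<le> \<delta>"
      by (auto simp: eventually_sequentially intro: less_imp_le)
    have le: "hausdorff_pre_measure s \<delta> (A \<inter> cball 0 (real R)) \<le> ennreal (c R / (1 - r) * r ^ M)" if "M \<ge> M0" for M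
    proof -
      have "hausdorff_pre_measure s \<delta> (A \<inter> cball 0 (real R)) \<le> (\<Sum>N. hausdorff_pre_measure s \<delta> (S R (N + M)))"
        by (rule order.trans[OF hausdorff_pre_measure_mono[OF A_sub] hausdorff_pre_measure_UN_le])
      also have "\<dots> \<le> (\<Sum>N. ennreal (c R * r ^ M * r ^ N))"
      proof (intro suminf_le summableI)
        fix N
        have "hausdorff_pre_measure s \<delta> (S R (N + M)) \<le> ennreal (c R * r ^ (N + M))"
          unfolding cr[symmetric] using that by (intro cover M0) auto
        then show "hausdorff_pre_measure s \<delta> (S R (N + M)) \<le> ennreal (c R * r ^ M * r ^ N)"
          by (simp add: power_add mult_ac)
      qed
      also have "\<dots> = ennreal (\<Sum>N. c R * r ^ M * r ^ N)"
        using r c by (intro suminf_ennreal2) (auto intro!: summable_mult)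
      also have "(\<Sum>N. c R * r ^ M * r ^ N) = c R / (1 - r) * r ^ M"
        using r by (simp add: suminf_mult suminf_geometric)
      finally show ?thesis .
    qed
    have "(\<lambda>M. ennreal (c R / (1 - r) * r ^ M)) \<longlonglongrightarrow> ennreal (c R / (1 - r) * 0)"
      using r by (intro tendsto_intros tendsto_ennrealI LIMSEQ_realpow_zero) auto
    then have "hausdorff_pre_measure s \<delta> (A \<inter> cball 0 (real R)) \<le> ennreal (c R / (1 - r) * 0)"
      using le by (intro Lim_bounded2) auto
    then show ?thesis by simp
  qed
  have "hausdorff_pre_measure s \<delta> A = 0" if "0 < \<delta>" for \<delta>
  proof -
    have "A \<subseteq> (\<Union>R::nat. A \<inter> cball 0 (real R))"
      using real_arch_simple by fastforce
    then have "hausdorff_pre_measure s \<delta> A \<le> (\<Sum>R. hausdorff_pre_measure s \<delta> (A \<inter> cball 0 (real R)))"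
      by (rule order.trans[OF hausdorff_pre_measure_mono hausdorff_pre_measure_UN_le])
    then show ?thesis using null[OF that] by simp
  qed
  then show ?thesis unfolding hausdorff_measure_def A_def[symmetric] by simp
qed

text \<open>Volume comparison. Disjoint balls of radius at most \<open>\<delta> \<le> 1\<close>
  centred in the ball of radius \<open>R\<close> fit into the ball of radius \<open>R + 1\<close>,
  so the sum of \<open>r^d\<close> is bounded. The remaining factor \<open>r^(s-d)\<close> is at
  most \<open>\<delta>^(s-d)\<close>, which tends to 0.\<close>

lemma packing_measure_greater_dim:
  fixes A :: "'a::euclidean_space set"
  assumes "real DIM('a) < s"
  shows "packing_measure s A = 0"
proof -
  define d where "d = DIM('a)"
  define v where "v = unit_ball_vol (real d)"
  have "0 < v" by (simp add: v_def)
  have cball: "measure lborel (cball x r) = v * r ^ d" if "0 \<le> r" for x :: 'a and r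
    using that by (simp add: content_cball v_def d_def)
  have pre: "packing_pre_measure s (cball (0::'a) (real R)) = 0" for R
  proof -
    define c where "c = 2 ^ d * (real R + 1) ^ d * 2 powr (s - d)"
    have le: "packing_pre_measure s (cball (0::'a) (real R)) \<le> ennreal (c * \<delta> powr (s - d))"
      if \<delta>: "0 < \<delta>" "\<delta> \<le> 1" for \<delta>
    proof -
      have "(\<Sum>(x, r)\<in>F. ennreal ((2 * r) powr s)) \<le> ennreal (c * \<delta> powr (s - d))"
        if "F \<in> packings \<delta> (cball (0::'a) (real R))" for F
      proof -
        have F: "finite F" "disjoint_family_on (\<lambda>(x, r). cball x r) F"
          "\<And>x r. (x, r) \<in> F \<Longrightarrow> norm x \<le> R \<and> 0 < r \<and> r \<le> \<delta>"
          using that by (auto simp: packings_def)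
        have "(\<Sum>p\<in>F. measure lborel (cball (fst p) (snd p))) = measure lborel (\<Union>p\<in>F. cball (fst p) (snd p))"
          using F(1,2) emeasure_bounded_finite[OF bounded_cball, THEN less_imp_neq]
          by (intro measure_finite_Union[symmetric]) (auto simp: case_prod_unfold)
        also have "\<dots> \<le> measure lborel (cball (0::'a) (real R + 1))"
        proof (rule measure_mono_fmeasurable)
          show "(\<Union>p\<in>F. cball (fst p) (snd p)) \<subseteq> cball (0::'a) (real R + 1)"
          proof clarify
            fix x r y assume p: "(x, r) \<in> F" "y \<in> cball (fst (x, r)) (snd (x, r))"
            have "norm y \<le> norm x + dist x y" by (metis dist_norm norm_minus_commute norm_triangle_sub)
            then show "y \<in> cball 0 (real R + 1)" using F(3)[OF p(1)] p(2) \<delta> by simp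
          qed
          show "(\<Union>p\<in>F. cball (fst p) (snd p)) \<in> sets lborel" using F(1) by auto
          show "cball (0::'a) (real R + 1) \<in> fmeasurable lborel"
            by (intro fmeasurableI emeasure_bounded_finite) auto
        qed
        also have "measure lborel (cball (0::'a) (real R + 1)) = v * (real R + 1) ^ d"
          by (rule cball) simp
        finally have vol: "(\<Sum>p\<in>F. measure lborel (cball (fst p) (snd p))) \<le> v * (real R + 1) ^ d" .
        have "(\<Sum>p\<in>F. (2 * snd p) powr s) \<le> (\<Sum>p\<in>F. (2 * \<delta>) powr (s - d) * 2 ^ d / v * measure lborel (cball (fst p) (snd p)))"
        proof (rule sum_mono)
          fix p assume "p \<in> F"
          then have r: "0 < snd p" "snd p \<le> \<delta>" using F(3)[of "fst p" "snd p"] by auto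
          have "(2 * snd p) powr s = (2 * snd p) powr (s - d) * (2 * snd p) powr d"
            by (simp flip: powr_add)
          also have "\<dots> \<le> (2 * \<delta>) powr (s - d) * (2 * snd p) powr d"
            using r assms by (intro mult_right_mono powr_mono2) (auto simp: d_def)
          also have "(2 * snd p) powr d = 2 ^ d * snd p ^ d"
            using r by (simp add: powr_realpow power_mult_distrib)
          finally show "(2 * snd p) powr s \<le> (2 * \<delta>) powr (s - d) * 2 ^ d / v * measure lborel (cball (fst p) (snd p))"
            using r \<open>0 < v\<close> by (simp add: cball mult_ac)
        qed
        also have "\<dots> = (2 * \<delta>) powr (s - d) * 2 ^ d / v * (\<Sum>p\<in>F. measure lborel (cball (fst p) (snd p)))"
          by (simp add: sum_distrib_left)
        also have "\<dots> \<le> (2 * \<delta>) powr (s - d) * 2 ^ d / v * (v * (real R + 1) ^ d)"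
          using \<open>0 < v\<close> by (intro mult_left_mono vol) auto
        also have "\<dots> = c * \<delta> powr (s - d)"
          using \<delta> \<open>0 < v\<close> by (simp add: c_def powr_mult mult_ac)
        finally have "(\<Sum>p\<in>F. (2 * snd p) powr s) \<le> c * \<delta> powr (s - d)" .
        then show ?thesis by (simp add: case_prod_unfold ennreal_leI)
      qed
      then have "(SUP F\<in>packings \<delta> (cball (0::'a) (real R)). \<Sum>(x, r)\<in>F. ennreal ((2 * r) powr s)) \<le> ennreal (c * \<delta> powr (s - d))"
        by (rule SUP_least)
      then show ?thesis unfolding packing_pre_measure_def using \<delta> by (intro INF_lower2[of \<delta>]) auto
    qed
    have "(\<lambda>k. ennreal (c * (1 / real (Suc k)) powr (s - d))) \<longlonglongrightarrow> ennreal (c * 0)"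
    proof (intro tendsto_ennrealI tendsto_mult tendsto_const)
      have "(\<lambda>k. (1 / real (Suc k)) powr (s - d)) \<longlonglongrightarrow> 0 powr (s - d)"
        using assms lim_inverse_n' [THEN LIMSEQ_Suc]
        by (intro tendsto_powr') (auto simp: d_def)
      then show "(\<lambda>k. (1 / real (Suc k)) powr (s - d)) \<longlonglongrightarrow> 0" using assms by (simp add: d_def)
    qed
    then have "packing_pre_measure s (cball (0::'a) (real R)) \<le> ennreal (c * 0)"
      by (rule Lim_bounded2) (use le in auto)
    then show ?thesis by simp
  qed
  have "A \<subseteq> (\<Union>R. cball 0 (real R))" using real_arch_simple by fastforce
  then have "packing_measure s A \<le> (\<Sum>R. packing_pre_measure s (cball (0::'a) (real R)))"
    unfolding packing_measure_def by (intro INF_lower) auto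
  then show ?thesis by (simp add: pre)
qed

subsection \<open>Lower bounds from expanding maps\<close>

text \<open>Preimages under an expanding map are taken of arbitrary covering sets, hence outer
  measure. Subadditivity follows from measurable hulls of equal measure.\<close>

lemma outer_measure_of_UN_le:
  assumes "\<And>i::nat. A i \<subseteq> space M"
  shows "outer_measure_of M (\<Union>i. A i) \<le> (\<Sum>i. outer_measure_of M (A i))"
proof -
  obtain E where E: "\<And>i. E i \<in> sets M" "\<And>i. A i \<subseteq> E i" "\<And>i. outer_measure_of M (A i) = emeasure M (E i)"
    using outer_measure_of_attain[OF assms] by metis
  have "outer_measure_of M (\<Union>i. A i) \<le> outer_measure_of M (\<Union>i. E i)"
    using E(2) by (intro outer_measure_of_mono) blast
  also have "\<dots> = emeasure M (\<Union>i. E i)" using E(1) by auto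
  also have "\<dots> \<le> (\<Sum>i. emeasure M (E i))"
    using E(1) by (intro emeasure_subadditive_countably) auto
  finally show ?thesis by (simp add: E(3))
qed

lemma outer_measure_of_finite_UN_le:
  assumes "finite I" "\<And>i. A i \<subseteq> space M"
  shows "outer_measure_of M (\<Union>i\<in>I. A i) \<le> (\<Sum>i\<in>I. outer_measure_of M (A i))"
proof -
  obtain E where E: "\<And>i. E i \<in> sets M" "\<And>i. A i \<subseteq> E i" "\<And>i. outer_measure_of M (A i) = emeasure M (E i)"
    using outer_measure_of_attain[OF assms(2)] by metis
  have "outer_measure_of M (\<Union>i\<in>I. A i) \<le> outer_measure_of M (\<Union>i\<in>I. E i)"
    using E(2) by (intro outer_measure_of_mono) blast
  also have "\<dots> = emeasure M (\<Union>i\<in>I. E i)" using E(1) assms(1)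
    by (intro outer_measure_of_eq sets.finite_UN) auto
  also have "\<dots> \<le> (\<Sum>i\<in>I. emeasure M (E i))"
    using E(1) assms(1) by (intro emeasure_subadditive_finite) auto
  finally show ?thesis by (simp add: E(3))
qed

text \<open>Fix one point of the preimage. By expansion, coordinate \<open>i\<close> of all others
  stays within \<open>2 / b^(F i m)\<close>, so the preimage lies in a box whose volume is governed
  by the total number of free digits below \<open>m\<close>.\<close>

lemma outer_measure_vimage_le:
  fixes g :: "real ^ 'n \<Rightarrow> 'a::metric_space"
  assumes "2 \<le> b"
    and g: "\<And>m y y' i. dist (g y) (g y') < 1 / real b ^ m \<Longrightarrow> \<bar>y $ i - y' $ i\<bar> < 2 / real b ^ F i m"
    and V: "\<And>u v. u \<in> V \<Longrightarrow> v \<in> V \<Longrightarrow> dist u v < 1 / real b ^ m"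
    and s: "s * real m - C \<le> real (\<Sum>i\<in>UNIV. F i m)"
  shows "outer_measure_of lborel (g -` V) \<le> ennreal (4 ^ CARD('n) * real b powr (C - s * real m))"
proof (cases "g -` V = {}")
  case False
  then obtain y0 where y0: "g y0 \<in> V" by auto
  define B where "B = cbox (\<chi> i. y0 $ i - 2 / real b ^ F i m) (\<chi> i. y0 $ i + 2 / real b ^ F i m)"
  have "g -` V \<subseteq> B"
  proof
    fix y assume "y \<in> g -` V"
    then have "dist (g y) (g y0) < 1 / real b ^ m" using V y0 by auto
    then have "\<bar>y $ i - y0 $ i\<bar> < 2 / real b ^ F i m" for i by (rule g)
    then show "y \<in> B" by (auto simp: B_def mem_box_cart abs_less_iff algebra_simps intro: less_imp_le)
  qed
  then have "outer_measure_of lborel (g -` V) \<le> outer_measure_of lborel B" by (rule outer_measure_of_mono)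
  also have "\<dots> = emeasure lborel B" by (simp add: B_def)
  also have "\<dots> = ennreal (measure lborel B)" 
    by (intro emeasure_eq_ennreal_measure) (simp add: B_def emeasure_lborel_cbox_finite[THEN less_imp_neq, simplified])
  also have "measure lborel B = 4 ^ CARD('n) / real b ^ (\<Sum>i\<in>UNIV. F i m)"
  proof -
    have "B \<noteq> {}" using \<open>g -` V \<subseteq> B\<close> False by blast
    then have "measure lborel B = (\<Prod>i\<in>UNIV. 4 / real b ^ F i m)"
      unfolding B_def by (subst content_cbox_cart) auto
    then show ?thesis by (simp add: prod_dividef power_sum)
  qed
  also have "\<dots> = 4 ^ CARD('n) * real b powr (- real (\<Sum>i\<in>UNIV. F i m))"
    using \<open>2 \<le> b\<close> by (simp add: powr_minus powr_realpow divide_inverse del: of_nat_sum)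
  also have "ennreal \<dots> \<le> ennreal (4 ^ CARD('n) * real b powr (C - s * real m))"
    using \<open>2 \<le> b\<close> s by (intro ennreal_leI mult_left_mono powr_mono) auto
  finally show ?thesis .
qed (simp add: outer_measure_of_eq)

text \<open>The preimage of a set \<open>U\<close> has outer measure at most a constant times
  \<open>diam_power s U\<close>. The preimages of a cover of \<open>A\<close> fill the whole space,
  whose measure is infinite, so every covering sum is infinite.\<close>

lemma hausdorff_measure_nonzero:
  fixes g :: "real ^ 'n \<Rightarrow> 'a::metric_space"
  assumes "2 \<le> b" "range g \<subseteq> A" "0 \<le> s"
    and g: "\<And>m y y' i. dist (g y) (g y') < 1 / real b ^ m \<Longrightarrow> \<bar>y $ i - y' $ i\<bar> < 2 / real b ^ F i m"
    and F: "\<And>m. s * real m - C \<le> real (\<Sum>i\<in>UNIV. F i m)"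
  shows "hausdorff_measure s A \<noteq> 0"
proof -
  have b: "1 < real b" using assms(1) by simp
  define K where "K = 4 ^ CARD('n) * real b powr (C + s)"
  have "0 < K" using b by (simp add: K_def)
  have ball: "outer_measure_of lborel (g -` U) \<le> ennreal K * diam_power s U"
    if U: "bounded U" "diameter U \<le> 1 / 2" for U
  proof -
    have small: "outer_measure_of lborel (g -` U) \<le> ennreal (4 ^ CARD('n) * real b powr (C - s * real m))"
      if "diameter U < 1 / real b ^ m" for m
      using diameter_bounded_bound[OF U(1)] that
      by (intro outer_measure_vimage_le[OF assms(1) g _ F]) force+
    show ?thesis
    proof (cases "U = {}")
      case False
      show ?thesis
      proof (cases "s = 0")
        case True
        \<comment> \<open>For \<open>s = 0\<close> a nonempty set has weight 1, and the scale
          \<open>m = 0\<close> applies since the diameter is at most 1/2.\<close>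
        then show ?thesis using small[of 0] U False by (simp add: K_def diam_power_def)
      next
        case s: False
        show ?thesis
        proof (cases "diameter U = 0")
          case True
          \<comment> \<open>A set of diameter 0 is smaller than every scale \<open>b^-m\<close>;
            letting \<open>m\<close> grow shows that its preimage is null.\<close>
          have "0 < s" using s assms(3) by simp
          then have "(\<lambda>m. (real b powr - s) ^ m) \<longlonglongrightarrow> 0"
            using b by (intro LIMSEQ_realpow_zero) (auto simp: powr_less_one)
          then have "(\<lambda>m. ennreal (4 ^ CARD('n) * real b powr C * (real b powr - s) ^ m)) \<longlonglongrightarrow>
              ennreal (4 ^ CARD('n) * real b powr C * 0)"
            by (intro tendsto_ennrealI tendsto_mult tendsto_const)
          moreover have "4 ^ CARD('n) * real b powr C * (real b powr - s) ^ m = 4 ^ CARD('n) * real b powr (C - s * real m)" for m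
          proof -
            have "(real b powr - s) ^ m = real b powr (- s * real m)"
              using powr_realpow[of "real b powr - s" m] b by (simp add: powr_powr)
            then show ?thesis by (simp add: powr_add[symmetric] mult.assoc)
          qed
          ultimately have "(\<lambda>m. ennreal (4 ^ CARD('n) * real b powr (C - s * real m))) \<longlonglongrightarrow> 0" by simp
          then have "outer_measure_of lborel (g -` U) \<le> 0"
            by (rule Lim_bounded2) (use small True b in auto)
          then show ?thesis by simp
        next
          case False
          define d where "d = diameter U"
          have d: "0 < d" "d \<le> 1 / 2" using False diameter_ge_0[OF U(1)] U(2) by (auto simp: d_def)
          obtain m0 where "(1 / real b) ^ m0 < d"
            using real_arch_pow_inv[of d "1 / real b"] d b by auto
          moreover have "(1 / real b) ^ Suc m0 \<le> (1 / real b) ^ m0" using b by (intro power_decreasing) auto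
          ultimately have "1 / real b ^ Suc m0 \<le> d" unfolding power_one_over by linarith
          then have ex: "\<exists>m. 1 / real b ^ Suc m \<le> d" by blast
          \<comment> \<open>The scale with \<open>b^-(m+1) \<le> d < b^-m\<close>. Passing from one
            end to the other costs the factor \<open>b^s\<close> included in \<open>K\<close>; if
            \<open>m = 0\<close>, the upper inequality comes from
            \<open>d \<le> 1/2\<close>.\<close>
          define m where "m = (LEAST m. 1 / real b ^ Suc m \<le> d)"
          have m: "1 / real b ^ Suc m \<le> d" unfolding m_def by (rule LeastI_ex[OF ex])
          have "d < 1 / real b ^ m"
          proof (cases m)
            case 0
            then show ?thesis using d by simp
          next
            case (Suc k)
            then have "\<not> 1 / real b ^ Suc k \<le> d" 
              using not_less_Least[of k "\<lambda>m. 1 / real b ^ Suc m \<le> d"] unfolding m_def by linarith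
            then show ?thesis using Suc by simp
          qed
          then have "outer_measure_of lborel (g -` U) \<le> ennreal (4 ^ CARD('n) * real b powr (C - s * real m))"
            unfolding d_def by (rule small)
          also have "4 ^ CARD('n) * real b powr (C - s * real m) = K * (1 / real b ^ Suc m) powr s"
          proof -
            have "1 / real b ^ Suc m = real b powr (- real (Suc m))"
              using b by (simp only: powr_minus powr_realpow divide_inverse mult_1_left)
            then have "(1 / real b ^ Suc m) powr s = real b powr (- real (Suc m) * s)" by (simp only: powr_powr)
            moreover have "C - s * real m = C + s + - real (Suc m) * s" by (simp add: algebra_simps)
            ultimately show ?thesis unfolding K_def by (simp only: powr_add mult.assoc)
          qed
          also have "ennreal (K * (1 / real b ^ Suc m) powr s) \<le> ennreal (K * d powr s)"
            using m b \<open>0 < K\<close> assms(3) by (intro ennreal_leI mult_left_mono powr_mono2) auto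
          also have "\<dots> = ennreal K * diam_power s U"
            using \<open>U \<noteq> {}\<close> s \<open>0 < K\<close> by (simp add: diam_power_def d_def ennreal_mult)
          finally show ?thesis .
        qed
      qed
    qed simp
  qed
  have "hausdorff_pre_measure s (1 / 2) A = top"
    unfolding hausdorff_pre_measure_def
  proof (rule INF_eqI)
    fix x
    fix U :: "nat \<Rightarrow> 'a set"
    assume "U \<in> {U. A \<subseteq> (\<Union>i. U i) \<and> (\<forall>i. bounded (U i) \<and> diameter (U i) \<le> 1 / 2)}"
    then have U: "A \<subseteq> (\<Union>i. U i)" "\<And>i. bounded (U i)" "\<And>i. diameter (U i) \<le> 1 / 2" by auto
    have eq: "(\<Union>i. g -` U i) = (UNIV :: (real ^ 'n) set)" using U(1) assms(2) by blast
    have "(\<infinity>::ennreal) = outer_measure_of lborel (\<Union>i. g -` U i)" unfolding eq by simp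
    also have "\<dots> \<le> (\<Sum>i. outer_measure_of lborel (g -` U i))" by (rule outer_measure_of_UN_le) simp
    also have "\<dots> \<le> (\<Sum>i. ennreal K * diam_power s (U i))" by (intro suminf_le ball U) auto
    also have "\<dots> = ennreal K * (\<Sum>i. diam_power s (U i))" by simp
    finally show "top \<le> (\<Sum>i. diam_power s (U i))"
      by (auto simp: top_unique ennreal_mult_eq_top_iff)
  qed auto
  then have "top \<le> hausdorff_measure s A"
    unfolding hausdorff_measure_def by (intro SUP_upper2[of "1/2"]) auto
  then show ?thesis by (auto simp: top_unique)
qed

text \<open>Good scales \<open>m\<close> need only be arbitrarily large: at such a scale a maximal
  separated subset of \<open>E\<close> gives a packing by balls of radius \<open>r\<close>, while
  the balls of radius \<open>2 * r\<close> cover \<open>E\<close>, so the packing sum dominates the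
  outer measure of the preimage of \<open>E\<close>. Countable covers of \<open>A\<close> then have
  infinite sums.\<close>

lemma packing_measure_nonzero:
  fixes g :: "real ^ 'n \<Rightarrow> 'a::metric_space"
  assumes "2 \<le> b" "range g \<subseteq> A"
    and g: "\<And>m y y' i. dist (g y) (g y') < 1 / real b ^ m \<Longrightarrow> \<bar>y $ i - y' $ i\<bar> < 2 / real b ^ F i m"
    and F: "\<And>M. \<exists>m\<ge>M. s * real m \<le> real (\<Sum>i\<in>UNIV. F i m)"
  shows "packing_measure s A \<noteq> 0"
proof -
  have b: "1 < real b" using assms(1) by simp
  define K where "K = 4 ^ CARD('n) * 4 powr s"
  have "0 < K" by (simp add: K_def)
  have pre: "ennreal (1 / K) * outer_measure_of lborel (g -` E) \<le> packing_pre_measure s E" for E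
    unfolding packing_pre_measure_def
  proof (rule INF_greatest)
    fix \<delta> :: real assume "\<delta> \<in> {0<..}"
    then have "0 < \<delta>" by simp
    define c where "c = (SUP F\<in>packings \<delta> E. \<Sum>(x, r)\<in>F. ennreal ((2 * r) powr s))"
    show "ennreal (1 / K) * outer_measure_of lborel (g -` E) \<le> (SUP F\<in>packings \<delta> E. \<Sum>(x, r)\<in>F. ennreal ((2 * r) powr s))"
      unfolding c_def[symmetric]
    proof (cases "c = top")
      case False
      obtain M where M: "(1 / real b) ^ M < \<delta>"
        using real_arch_pow_inv[of \<delta> "1 / real b"] \<open>0 < \<delta>\<close> b by auto
      obtain m where m: "m \<ge> M" "s * real m \<le> real (\<Sum>i\<in>UNIV. F i m)" using F by blast
      \<comment> \<open>A ball of radius \<open>2 * r\<close> has diameter at most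
        \<open>4 * r\<close>, half of \<open>b^-m\<close>, hence strictly below the scale. The
        relation \<open>b^-m = 4 * (2 * r)\<close> is the origin of \<open>4 powr s\<close> in
        \<open>K\<close>.\<close>
      define r where "r = (1 / real b ^ m) / 8"
      have "(1 / real b) ^ m \<le> (1 / real b) ^ M" using m b by (intro power_decreasing) auto
      then have "1 / real b ^ m < \<delta>" using M by (simp add: power_divide)
      then have r: "0 < r" "r \<le> \<delta>" using b \<open>0 < \<delta>\<close> unfolding r_def by auto
      define P where "P D \<longleftrightarrow> finite D \<and> D \<subseteq> E \<and> pairwise (\<lambda>x y. 2 * r < dist x y) D" for D
      have card_le: "ennreal (real (card D) * (2 * r) powr s) \<le> c" if "P D" for D
      proof -
        have "(\<lambda>x. (x, r)) ` D \<in> packings \<delta> E"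
        proof -
          have "cball x r \<inter> cball y r = {}" if "x \<in> D" "y \<in> D" "x \<noteq> y" for x y
          proof -
            have "2 * r < dist x y" using \<open>P D\<close> that by (auto simp: P_def pairwise_def)
            show ?thesis
            proof (rule ccontr)
              assume "cball x r \<inter> cball y r \<noteq> {}"
              then obtain z where "dist x z \<le> r" "dist y z \<le> r" by auto
              then show False using \<open>2 * r < dist x y\<close> dist_triangle2[of x y z] by linarith
            qed
          qed
          then show ?thesis using \<open>P D\<close> r
            by (auto simp: packings_def P_def disjoint_family_on_def)
        qed
        then have "(\<Sum>(x, r)\<in>(\<lambda>x. (x, r)) ` D. ennreal ((2 * r) powr s)) \<le> c"
          unfolding c_def by (rule SUP_upper)
        moreover have "(\<Sum>(x, r)\<in>(\<lambda>x. (x, r)) ` D. ennreal ((2 * r) powr s)) = (\<Sum>x\<in>D. ennreal ((2 * r) powr s))"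
          by (subst sum.reindex) (auto intro: inj_onI)
        ultimately show ?thesis by (simp add: ennreal_mult ennreal_of_nat_eq_real_of_nat)
      qed
      have "P {}" by (simp add: P_def)
      \<comment> \<open>A finite value \<open>c\<close> bounds the cardinality of separated sets, so
        one of largest cardinality exists; a point outside the balls of radius \<open>2 * r\<close>
        could be added to it.\<close>
      moreover have "\<forall>D. P D \<longrightarrow> card D < Suc (nat \<lceil>enn2real c / (2 * r) powr s\<rceil>)"
      proof (intro allI impI)
        fix D assume "P D"
        then have "ennreal (real (card D) * (2 * r) powr s) \<le> ennreal (enn2real c)"
          using card_le False by (simp add: less_top)
        then have "real (card D) * (2 * r) powr s \<le> enn2real c" by (simp add: ennreal_le_iff)
        then have "real (card D) \<le> enn2real c / (2 * r) powr s" using r by (simp add: field_simps)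
        then show "card D < Suc (nat \<lceil>enn2real c / (2 * r) powr s\<rceil>)" by linarith
      qed
      ultimately obtain D where D: "P D" and max: "\<And>D'. P D' \<Longrightarrow> card D' \<le> card D"
        using Lattices_Big.ex_has_greatest_nat[of P "{}" card] by blast
      have "E \<subseteq> (\<Union>d\<in>D. cball d (2 * r))"
      proof (rule subsetI, rule ccontr)
        fix x assume x: "x \<in> E" "x \<notin> (\<Union>d\<in>D. cball d (2 * r))"
        then have "x \<notin> D" using r by force
        have far: "2 * r < dist d x" if "d \<in> D" for d using x that by (auto simp: not_le)
        then have "P (insert x D)"
          using D x(1) by (auto simp: P_def pairwise_insert dist_commute)
        then have "card (insert x D) \<le> card D" by (rule max)
        then show False using \<open>x \<notin> D\<close> D by (simp add: P_def)
      qed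
      then have "g -` E \<subseteq> (\<Union>d\<in>D. g -` cball d (2 * r))" by blast
      then have "outer_measure_of lborel (g -` E) \<le> outer_measure_of lborel (\<Union>d\<in>D. g -` cball d (2 * r))"
        by (rule outer_measure_of_mono)
      also have "\<dots> \<le> (\<Sum>d\<in>D. outer_measure_of lborel (g -` cball d (2 * r)))"
        using D by (intro outer_measure_of_finite_UN_le) (auto simp: P_def)
      also have "\<dots> \<le> (\<Sum>d\<in>D. ennreal (K * (2 * r) powr s))"
      proof (rule sum_mono)
        fix d
        have "outer_measure_of lborel (g -` cball d (2 * r)) \<le> ennreal (4 ^ CARD('n) * real b powr (0 - s * real m))"
        proof (rule outer_measure_vimage_le[OF assms(1) g])
          fix u v assume "u \<in> cball d (2 * r)" "v \<in> cball d (2 * r)"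
          then have "dist u v \<le> 4 * r" using dist_triangle3[of u v d] by simp
          also have "\<dots> < 8 * r" using r by simp
          also have "\<dots> = 1 / real b ^ m" by (simp add: r_def)
          finally show "dist u v < 1 / real b ^ m" .
        qed (use m in auto)
        also have "4 ^ CARD('n) * real b powr (0 - s * real m) = K * (2 * r) powr s"
        proof -
          have "real b powr (0 - s * real m) = (1 / real b ^ m) powr s"
          proof -
            have "1 / real b ^ m = real b powr (- real m)"
              using b by (simp add: powr_minus powr_realpow divide_inverse)
            then show ?thesis by (simp add: powr_powr mult.commute)
          qed
          also have "1 / real b ^ m = 4 * (2 * r)" by (simp add: r_def)
          also have "\<dots> powr s = 4 powr s * (2 * r) powr s" by (rule powr_mult)
          finally show ?thesis by (simp add: K_def)
        qed
        finally show "outer_measure_of lborel (g -` cball d (2 * r)) \<le> ennreal (K * (2 * r) powr s)" .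
      qed
      also have "\<dots> = ennreal K * ennreal (real (card D) * (2 * r) powr s)"
        using \<open>0 < K\<close> by (simp add: ennreal_mult ennreal_of_nat_eq_real_of_nat mult_ac)
      also have "\<dots> \<le> ennreal K * c" using card_le[OF D] by (rule mult_left_mono) simp
      finally have "ennreal (1 / K) * outer_measure_of lborel (g -` E) \<le> ennreal (1 / K) * (ennreal K * c)"
        by (rule mult_left_mono) simp
      also have "\<dots> = c" using \<open>0 < K\<close> by (simp flip: mult.assoc ennreal_mult)
      finally show "ennreal (1 / K) * outer_measure_of lborel (g -` E) \<le> c" .
    qed simp
  qed
  have "packing_measure s A = top"
    unfolding packing_measure_def
  proof (rule INF_eqI)
    fix E :: "nat \<Rightarrow> 'a set"
    assume "E \<in> {E. A \<subseteq> (\<Union>i. E i)}"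
    then have eq: "(\<Union>i. g -` E i) = (UNIV :: (real ^ 'n) set)" using assms(2) by blast
    have "(\<infinity>::ennreal) = outer_measure_of lborel (\<Union>i. g -` E i)" unfolding eq by simp
    also have "\<dots> \<le> (\<Sum>i. outer_measure_of lborel (g -` E i))" by (rule outer_measure_of_UN_le) simp
    finally have "ennreal (1 / K) * \<infinity> \<le> ennreal (1 / K) * (\<Sum>i. outer_measure_of lborel (g -` E i))"
      by (rule mult_left_mono) simp
    also have "\<dots> = (\<Sum>i. ennreal (1 / K) * outer_measure_of lborel (g -` E i))" by simp
    also have "\<dots> \<le> (\<Sum>i. packing_pre_measure s (E i))" by (intro suminf_le pre) auto
    finally show "top \<le> (\<Sum>i. packing_pre_measure s (E i))"
      using \<open>0 < K\<close> by (simp add: ennreal_mult_top)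
  qed auto
  then show ?thesis by simp
qed

subsection \<open>Products of level sets\<close>

lemma one_div_ereal_real: "1 \<le> r \<Longrightarrow> 1 / ereal r = ereal (1 / r)"
  by (simp add: divide_ereal_def divide_inverse)

lemma one_div_ereal_cases:
  fixes x :: ereal
  assumes "1 \<le> x"
  obtains r where "1 / x = ereal r" "0 \<le> r" "r \<le> 1"
proof (cases x)
  case (real a)
  then show ?thesis using assms by (intro that[of "1 / a"]) (auto simp: one_div_ereal_real)
qed (use assms that[of 0] in auto)

lemma one_div_ereal_antimono:
  fixes x y :: ereal
  assumes "1 \<le> x" "x \<le> y"
  shows "1 / y \<le> 1 / x"
proof -
  have "inverse y \<le> inverse x" using assms by (intro ereal_inverse_antimono) (auto intro: order.trans[of 0 1])
  then show ?thesis by (simp add: divide_ereal_def)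
qed

lemma sqrt_le_linear_eventually:
  fixes \<delta> a c :: real
  assumes "0 < \<delta>" "0 \<le> a" "0 \<le> c"
  shows "\<exists>M. \<forall>m\<ge>M. a * sqrt (real m) + c \<le> \<delta> * m"
proof (intro exI allI impI)
  define M where "M = Suc (nat \<lceil>((a + c) / \<delta>)\<^sup>2\<rceil>)"
  fix m assume "M \<le> m"
  then have m: "1 \<le> real m" "((a + c) / \<delta>)\<^sup>2 \<le> m" unfolding M_def by linarith+
  define t where "t = sqrt m"
  have t: "1 \<le> t" "(a + c) / \<delta> \<le> t" "t * t = m"
    unfolding t_def using m by (auto simp: real_le_rsqrt)
  have "a * t + c \<le> a * t + c * t" using t assms by (simp add: mult_left_mono[of 1 t c, simplified])
  also have "\<dots> = (a + c) * t" by (simp add: algebra_simps)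
  also have "\<dots> \<le> (\<delta> * t) * t" using t assms by (intro mult_right_mono) (auto simp: field_simps)
  also have "\<dots> = \<delta> * m" by (simp add: t(3)[symmetric])
  finally show "a * sqrt (real m) + c \<le> \<delta> * m" by (simp add: t_def)
qed

lemma ex_block:
  assumes "block_start k0 \<le> m"
  shows "\<exists>k\<ge>k0. block_start k \<le> m \<and> m \<le> block_start (Suc k)"
proof -
  have "\<forall>k. block_start k \<le> m \<longrightarrow> k \<le> m" using le_block_start order.trans by blast
  then obtain k where k: "block_start k \<le> m" "\<And>k'. block_start k' \<le> m \<Longrightarrow> k' \<le> k"
    using Nat.ex_has_greatest_nat[of "\<lambda>k. block_start k \<le> m" k0 m] assms by blast
  moreover have "\<not> block_start (Suc k) \<le> m" using k(2)[of "Suc k"] by auto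
  ultimately show ?thesis using k(2)[OF assms] by (intro exI[of _ k]) auto
qed

text \<open>As \<open>h\<close> enumerates the coordinates, block \<open>k\<close> occurs in exactly
  one of them, the one with \<open>h i = k mod n\<close>. So the loss of a positive proportion is
  incurred only once, and it is largest for the largest exponent.\<close>

lemma sum_card_free_position:
  fixes l :: "'n::finite \<Rightarrow> ereal" and h :: "'n \<Rightarrow> nat"
  assumes l: "\<And>i. 1 \<le> l i" and h: "bij_betw h UNIV {0..<CARD('n)}"
    and k: "1 \<le> k" "block_start k \<le> m" "m \<le> block_start (Suc k)"
  defines "F \<equiv> \<lambda>i. card {j. j < m \<and> free_position (l i) {k. k mod CARD('n) = h i} j}"
  shows "real CARD('n) * m - real CARD('n) * (m / (real k)\<^sup>2 + 2 * sqrt m + 2)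
            - (m * (1 - real_of_ereal (1 / Max (range l))) + 1) \<le> real (\<Sum>i\<in>UNIV. F i)"
    and "m = block_start k \<Longrightarrow>
       real CARD('n) * m - real CARD('n) * (m / (real k)\<^sup>2 + 2 * sqrt m + 2) \<le> real (\<Sum>i\<in>UNIV. F i)"
proof -
  define K where "K i = {k. k mod CARD('n) = h i}" for i
  define e where "e = m / (real k)\<^sup>2 + 2 * sqrt m + 2"
  define B where "B i = (if k \<in> K i then real (min (block_end (l i) k) m - block_start k) else 0)" for i
  have F: "real m - e - B i \<le> F i" for i
  proof -
    have "{..<m} = {j. j < m \<and> free_position (l i) (K i) j} \<union> {j. j < m \<and> \<not> free_position (l i) (K i) j}" by auto
    then have "card {..<m} = F i + card {j. j < m \<and> \<not> free_position (l i) (K i) j}"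
      unfolding F_def K_def by (subst card_Un_disjoint[symmetric]) auto
    then have "real m = real (F i) + card {j. j < m \<and> \<not> free_position (l i) (K i) j}" by simp
    then show ?thesis using card_not_free_le[OF l k, of i "K i"] by (simp add: e_def B_def)
  qed
  have "(\<Sum>i\<in>UNIV. real m - e - B i) \<le> (\<Sum>i\<in>UNIV. real (F i))" by (intro sum_mono F)
  then have sum: "real CARD('n) * m - real CARD('n) * e - (\<Sum>i\<in>UNIV. B i) \<le> real (\<Sum>i\<in>UNIV. F i)"
    by (simp add: sum_subtractf right_diff_distrib)
  have "k mod CARD('n) \<in> h ` UNIV" using h by (simp add: bij_betw_def)
  then obtain i0 where i0: "h i0 = k mod CARD('n)" by force
  have inj: "i = i0" if "k \<in> K i" for i using that i0 h by (auto simp: K_def bij_betw_def inj_def)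
  have "(\<Sum>i\<in>UNIV. B i) = (\<Sum>i\<in>{i0}. B i)"
    using inj by (intro sum.mono_neutral_right) (auto simp: B_def)
  also have "\<dots> \<le> real (min (block_end (l i0) k) m - block_start k)" by (simp add: B_def)
  also have "\<dots> \<le> m * (1 - real_of_ereal (1 / l i0)) + 1" by (rule block_length_le[OF l])
  also have "\<dots> \<le> m * (1 - real_of_ereal (1 / Max (range l))) + 1"
  proof -
    have M: "l i0 \<le> Max (range l)" by simp
    obtain a where a: "1 / l i0 = ereal a" using one_div_ereal_cases[OF l] by blast
    obtain c where c: "1 / Max (range l) = ereal c" using one_div_ereal_cases[OF order.trans[OF l M]] by blast
    have "c \<le> a" using one_div_ereal_antimono[OF l M] by (simp add: a c)
    then show ?thesis by (simp add: a c mult_left_mono)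
  qed
  finally show "real CARD('n) * m - real CARD('n) * (m / (real k)\<^sup>2 + 2 * sqrt m + 2)
            - (m * (1 - real_of_ereal (1 / Max (range l))) + 1) \<le> real (\<Sum>i\<in>UNIV. F i)"
    using sum unfolding e_def by linarith
  show "real CARD('n) * m - real CARD('n) * (m / (real k)\<^sup>2 + 2 * sqrt m + 2) \<le> real (\<Sum>i\<in>UNIV. F i)"
    if "m = block_start k"
  proof -
    \<comment> \<open>At \<open>m = block_start k\<close> the current block has not begun, so its
      part below \<open>m\<close> is empty in every coordinate.\<close>
    have "(\<Sum>i\<in>UNIV. B i) = 0" using that by (intro sum.neutral) (auto simp: B_def)
    then show ?thesis using sum unfolding e_def by linarith
  qed
qed

lemma badic_level_prod_expanding_map:
  fixes l :: "'n::finite \<Rightarrow> ereal"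
  assumes "2 \<le> b" "\<And>i. 1 \<le> l i" "\<And>i. infinite (K i)"
  shows "\<exists>g :: real ^ 'n \<Rightarrow> real ^ 'n. range g \<subseteq> badic_level_prod b l \<and>
    (\<forall>m y y' i. dist (g y) (g y') < 1 / real b ^ m \<longrightarrow>
       \<bar>y $ i - y' $ i\<bar> < 2 / real b ^ card {j. j < m \<and> free_position (l i) (K i) j})"
proof -
  have "\<forall>i. \<exists>g. (\<forall>y. badic_exponent b (g y) = l i) \<and> (\<forall>m y y'. \<bar>g y - g y'\<bar> < 1 / real b ^ m \<longrightarrow>
      \<bar>y - y'\<bar> < 2 / real b ^ card {j. j < m \<and> free_position (l i) (K i) j})"
    using badic_exponent_expanding_map[OF assms] by blast
  from choice[OF this] obtain g where g: "\<And>i y. badic_exponent b (g i y) = l i"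
    "\<And>i m y y'. \<bar>g i y - g i y'\<bar> < 1 / real b ^ m \<Longrightarrow>
      \<bar>y - y'\<bar> < 2 / real b ^ card {j. j < m \<and> free_position (l i) (K i) j}"
    by blast
  define G where "G y = (\<chi> i. g i (y $ i))" for y :: "real ^ 'n"
  have "range G \<subseteq> badic_level_prod b l"
    by (auto simp: G_def badic_level_prod_def badic_level_set_def g)
  moreover have "\<bar>y $ i - y' $ i\<bar> < 2 / real b ^ card {j. j < m \<and> free_position (l i) (K i) j}"
    if "dist (G y) (G y') < 1 / real b ^ m" for m y y' i
  proof (rule g(2))
    have "dist (G y $ i) (G y' $ i) \<le> dist (G y) (G y')" by (rule dist_vec_nth_le)
    then show "\<bar>g i (y $ i) - g i (y' $ i)\<bar> < 1 / real b ^ m" using that by (simp add: G_def dist_real_def)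
  qed
  ultimately show ?thesis by blast
qed

lemma infinite_residue_class:
  assumes "r < (n::nat)"
  shows "infinite {k. k mod n = r}"
  unfolding infinite_nat_iff_unbounded_le
proof
  fix m
  have "m \<le> r + n * m" using assms by (cases n) auto
  moreover have "(r + n * m) mod n = r" using assms by simp
  ultimately show "\<exists>k\<ge>m. k \<in> {k. k mod n = r}" by blast
qed

text \<open>The residue classes modulo the number of coordinates stagger the blocks. The Hausdorff
  bound needs a digit count at every scale, the packing bound only at the block starts.\<close>

lemma
  fixes l :: "'n::finite \<Rightarrow> ereal"
  assumes "2 \<le> b" "\<And>i. 1 \<le> l i"
  shows hausdorff_dim_badic_level_prod_ge:
      "ereal (real CARD('n) - 1) + 1 / Max (range l) \<le> hausdorff_dim (badic_level_prod b l)"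
    and packing_dim_badic_level_prod_ge: "ereal (real CARD('n)) \<le> packing_dim (badic_level_prod b l)"
proof -
  define n where "n = CARD('n)"
  have "1 \<le> n" by (simp add: n_def Suc_leI)
  obtain h :: "'n \<Rightarrow> nat" where h: "bij_betw h UNIV {0..<CARD('n)}"
    using ex_bij_betw_finite_nat[OF finite, of "UNIV :: 'n set"] by blast
  define K where "K i = {k. k mod CARD('n) = h i}" for i
  have K: "infinite (K i)" for i
    unfolding K_def using h by (intro infinite_residue_class) (auto simp: bij_betw_def)
  define F where "F i m = card {j. j < m \<and> free_position (l i) (K i) j}" for i m
  obtain g :: "real ^ 'n \<Rightarrow> real ^ 'n" where g: "range g \<subseteq> badic_level_prod b l"
    "\<And>m y y' i. dist (g y) (g y') < 1 / real b ^ m \<Longrightarrow> \<bar>y $ i - y' $ i\<bar> < 2 / real b ^ F i m"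
    using badic_level_prod_expanding_map[of b l K, OF assms K] unfolding F_def by blast
  have "1 \<le> Max (range l)" using assms(2) by (meson Max_ge UNIV_I finite finite_imageI image_eqI order.trans)
  then obtain \<kappa> where \<kappa>: "1 / Max (range l) = ereal \<kappa>" "0 \<le> \<kappa>" using one_div_ereal_cases by blast
  have quot: "n * (m / (real k)\<^sup>2) \<le> \<delta> * m" if "0 < \<delta>" "n / \<delta> \<le> k" "1 \<le> k" for \<delta> :: real and k m :: nat
  proof -
    have "real k \<le> (real k)\<^sup>2" using that(3) by (simp add: power2_eq_square)
    then have "n / \<delta> \<le> (real k)\<^sup>2" using that(2) by linarith
    then have "n / (real k)\<^sup>2 \<le> \<delta>" using that by (simp add: field_simps)
    then have "n / (real k)\<^sup>2 * m \<le> \<delta> * m" by (intro mult_right_mono) auto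
    then show ?thesis by simp
  qed

  show "ereal (real CARD('n) - 1) + 1 / Max (range l) \<le> hausdorff_dim (badic_level_prod b l)"
  proof (rule hausdorff_dim_geI)
    fix s :: real
    assume s: "0 \<le> s" "ereal s < ereal (real CARD('n) - 1) + 1 / Max (range l)"
    \<comment> \<open>Half of the available gap: \<open>\<delta> * m\<close> pays for the earlier
      blocks, a second \<open>\<delta> * m\<close> for the square roots and constants.\<close>
    define \<delta> where "\<delta> = (real n - 1 + \<kappa> - s) / 2"
    have "0 < \<delta>" using s by (simp add: \<delta>_def \<kappa> n_def)
    obtain M1 where M1: "\<And>m. m \<ge> M1 \<Longrightarrow> (2 * real n) * sqrt (real m) + (2 * real n + 1) \<le> \<delta> * m"
      using sqrt_le_linear_eventually[OF \<open>0 < \<delta>\<close>, of "2 * real n" "2 * real n + 1"] by auto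
    define k0 where "k0 = Suc (nat \<lceil>n / \<delta>\<rceil>)"
    define M where "M = max M1 (block_start k0)"
    have *: "s * real m \<le> real (\<Sum>i\<in>UNIV. F i m)" if "m \<ge> M" for m
    proof -
      have m: "block_start k0 \<le> m" "M1 \<le> m" using that by (auto simp: M_def)
      obtain k where k: "k0 \<le> k" "block_start k \<le> m" "m \<le> block_start (Suc k)" using ex_block[OF m(1)] by blast
      have k': "1 \<le> k" "n / \<delta> \<le> k" using k(1) unfolding k0_def by linarith+
      have "real n * m - real n * (m / (real k)\<^sup>2 + 2 * sqrt m + 2) - (m * (1 - \<kappa>) + 1) \<le> real (\<Sum>i\<in>UNIV. F i m)"
        using sum_card_free_position(1)[where l = l, OF assms(2) h k'(1) k(2,3)]
        unfolding n_def F_def K_def \<kappa>(1) real_of_ereal.simps .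
      moreover have "real n * (m / (real k)\<^sup>2) \<le> \<delta> * m" using quot[OF \<open>0 < \<delta>\<close> k'(2,1)] .
      moreover have "s * m = real n * m - m + \<kappa> * m - 2 * (\<delta> * m)" by (simp add: \<delta>_def field_simps)
      ultimately show ?thesis using M1[OF m(2)] by (simp add: algebra_simps)
    qed
    show "hausdorff_measure s (badic_level_prod b l) \<noteq> 0"
    proof (rule hausdorff_measure_nonzero[OF assms(1) g(1) s(1) g(2)])
      \<comment> \<open>The additive constant \<open>s * M\<close> absorbs the scales below
        \<open>M\<close>, where the digit count is only known to be nonnegative.\<close>
      fix m show "s * real m - s * M \<le> real (\<Sum>i\<in>UNIV. F i m)"
      proof (cases "M \<le> m")
        case True
        then show ?thesis using *[of m] s(1) by (smt (verit) mult_nonneg_nonneg of_nat_0_le_iff)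
      next
        case False
        then have "s * real m \<le> s * M" using s(1) by (intro mult_left_mono) auto
        then show ?thesis by (smt (verit) of_nat_0_le_iff)
      qed
    qed
  qed
  show "ereal (real CARD('n)) \<le> packing_dim (badic_level_prod b l)"
  proof (rule packing_dim_geI)
    fix s :: real
    assume s: "ereal s < ereal (real CARD('n))"
    define \<delta> where "\<delta> = (real n - s) / 2"
    have "0 < \<delta>" using s by (simp add: \<delta>_def n_def)
    obtain M1 where M1: "\<And>m. m \<ge> M1 \<Longrightarrow> (2 * real n) * sqrt (real m) + 2 * real n \<le> \<delta> * m"
      using sqrt_le_linear_eventually[OF \<open>0 < \<delta>\<close>, of "2 * real n" "2 * real n"] by auto
    show "packing_measure s (badic_level_prod b l) \<noteq> 0"
    proof (rule packing_measure_nonzero[OF assms(1) g])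
      fix M
      \<comment> \<open>Large enough for both error estimates and, because
        \<open>k \<le> block_start k\<close>, for the scale to exceed \<open>M\<close>.\<close>
      define k where "k = max M (max M1 (Suc (nat \<lceil>n / \<delta>\<rceil>)))"
      have k: "1 \<le> k" "n / \<delta> \<le> k" "M \<le> k" "M1 \<le> k" unfolding k_def by linarith+
      define m where "m = block_start k"
      have "k \<le> m" by (simp add: m_def le_block_start)
      have "real n * m - real n * (m / (real k)\<^sup>2 + 2 * sqrt m + 2) \<le> real (\<Sum>i\<in>UNIV. F i m)"
        using sum_card_free_position(2)[where l = l, OF assms(2) h k(1), of m] block_start_mono[of k "Suc k"]
        unfolding n_def F_def K_def m_def by simp
      moreover have "real n * (m / (real k)\<^sup>2) \<le> \<delta> * m" using quot[OF \<open>0 < \<delta>\<close> k(2,1)] .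
      moreover have "s * m = real n * m - 2 * (\<delta> * m)" by (simp add: \<delta>_def field_simps)
      ultimately have "s * real m \<le> real (\<Sum>i\<in>UNIV. F i m)"
        using M1[of m] k(4) \<open>k \<le> m\<close> by (simp add: algebra_simps)
      then show "\<exists>m\<ge>M. s * real m \<le> real (\<Sum>i\<in>UNIV. F i m)"
        using k(3) \<open>k \<le> m\<close> by (intro exI[of _ m]) auto
    qed
  qed
qed

text \<open>One coordinate suffices: exponent \<open>l\<close> exceeds every
  \<open>\<mu> < l\<close>, and \<open>\<mu>\<close> can be taken so close to \<open>l\<close> that
  \<open>1 / \<mu>\<close> stays below the excess \<open>t\<close> of \<open>s\<close> over
  \<open>d - 1\<close>. A general Euclidean space covers both products and single level
  sets.\<close>

lemma hausdorff_dim_le_of_badic_exponent: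
  fixes i :: "'a::euclidean_space"
  assumes "2 \<le> b" "1 \<le> l" "i \<in> Basis" and A: "A \<subseteq> {x. badic_exponent b (x \<bullet> i) = l}"
  shows "hausdorff_dim A \<le> ereal (real DIM('a) - 1) + 1 / l"
proof -
  obtain \<kappa> where \<kappa>: "1 / l = ereal \<kappa>" "0 \<le> \<kappa>" using one_div_ereal_cases[OF assms(2)] by blast
  have "1 \<le> real DIM('a)" using DIM_positive[where 'a = 'a] by linarith
  show ?thesis
  proof (rule hausdorff_dim_leI)
    show "0 \<le> ereal (real DIM('a) - 1) + 1 / l" using \<kappa> \<open>1 \<le> real DIM('a)\<close> by simp
    fix s assume "ereal (real DIM('a) - 1) + 1 / l < ereal s"
    define t where "t = s - (real DIM('a) - 1)"
    have t: "1 / l < ereal t" "0 < t" using \<open>_ < ereal s\<close> \<kappa> by (auto simp: t_def)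
    have "ereal (1 / t) < l"
    proof (cases l)
      case (real r)
      then have "1 \<le> r" "1 / l = ereal (1 / r)" using assms(2) by (auto simp: one_div_ereal_real)
      then show ?thesis using t by (simp add: real field_simps)
    qed (use assms(2) in auto)
    then obtain \<mu> where \<mu>: "ereal (1 / t) < ereal \<mu>" "ereal \<mu> < l" using ereal_dense2 by blast
    have "0 < \<mu>" using \<mu>(1) t(2) by (simp add: order.strict_trans[of 0 "1 / t"])
    then have "1 / \<mu> < t" using \<mu>(1) t(2) by (simp add: field_simps)
    then have "real DIM('a) - 1 + 1 / \<mu> < s" by (simp add: t_def)
    then have "hausdorff_measure s {x. ereal \<mu> < badic_exponent b (x \<bullet> i)} = 0"
      by (rule hausdorff_measure_badic_exponent_greater[OF assms(1,3) \<open>0 < \<mu>\<close>])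
    moreover have "A \<subseteq> {x. ereal \<mu> < badic_exponent b (x \<bullet> i)}" using A \<mu>(2) by auto
    ultimately show "hausdorff_measure s A = 0" using hausdorff_measure_mono by (metis le_zero_eq)
  qed
qed

text \<open>For the upper bounds, a coordinate of largest exponent controls the Hausdorff dimension,
  and the ambient dimension bounds the packing dimension.\<close>

lemma
  fixes l :: "'n::finite \<Rightarrow> ereal"
  assumes "2 \<le> b" "\<And>i. 1 \<le> l i"
  shows hausdorff_dim_badic_level_prod:
      "hausdorff_dim (badic_level_prod b l) = ereal (real CARD('n) - 1) + 1 / Max (range l)"
    and packing_dim_badic_level_prod: "packing_dim (badic_level_prod b l) = ereal (real CARD('n))"
proof -
  have "Max (range l) \<in> range l" by (intro Max_in) auto
  then obtain i where i: "Max (range l) = l i" by (rule rangeE)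
  have "hausdorff_dim (badic_level_prod b l) \<le> ereal (real DIM(real ^ 'n) - 1) + 1 / Max (range l)"
    using assms
    by (intro hausdorff_dim_le_of_badic_exponent[where i = "axis i 1"])
       (auto simp: badic_level_prod_def badic_level_set_def inner_axis i axis_in_Basis_iff)
  then show "hausdorff_dim (badic_level_prod b l) = ereal (real CARD('n) - 1) + 1 / Max (range l)"
    using hausdorff_dim_badic_level_prod_ge[where l = l, OF assms] by (intro antisym) auto
  have "packing_dim (badic_level_prod b l) \<le> ereal (real CARD('n))"
    by (intro packing_dim_leI packing_measure_greater_dim) auto
  then show "packing_dim (badic_level_prod b l) = ereal (real CARD('n))"
    using packing_dim_badic_level_prod_ge[where l = l, OF assms] by (intro antisym) auto
qed

theorem theorem3p2:
  shows "(\<forall>b\<ge>2. \<forall>l :: 'n::finite \<Rightarrow> ereal. (\<forall>i. 1 \<le> l i) \<longrightarrow>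
            ereal (real CARD('n) - 1) + 1 / Max (range l) \<ge> hausdorff_dim (badic_level_prod b l) \<and>
            hausdorff_dim (badic_level_prod b l) \<ge> max (ereal (real CARD('n) - 1)) (\<Sum>i\<in>UNIV. 1 / l i))
       \<and> (CARD('n) \<ge> 2 \<longrightarrow>
            (\<exists>T::real. \<forall>b\<ge>2. \<forall>l :: 'n \<Rightarrow> ereal. (\<forall>i. 1 \<le> l i) \<and> (\<forall>i. l i > ereal T) \<longrightarrow>
               hausdorff_dim (badic_level_prod b l) > (\<Sum>i\<in>UNIV. hausdorff_dim (badic_level_set b (l i)))))
       \<and> (\<forall>b\<ge>2.
            ((\<lambda>l :: 'n \<Rightarrow> ereal. hausdorff_dim (badic_level_prod b l)) \<longlongrightarrow> ereal (real CARD('n) - 1))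
               max_to_infinity \<and>
            ((\<lambda>l :: 'n \<Rightarrow> ereal. packing_dim (badic_level_prod b l)) \<longlongrightarrow> ereal (real CARD('n)))
               max_to_infinity)"
proof (intro conjI allI impI)
  fix b :: nat and l :: "'n \<Rightarrow> ereal"
  assume b: "2 \<le> b" and "\<forall>i. 1 \<le> l i"
  then have l: "\<And>i. 1 \<le> l i" by blast
  note dim = hausdorff_dim_badic_level_prod[where l = l, OF b l]
  show "hausdorff_dim (badic_level_prod b l) \<le> ereal (real CARD('n) - 1) + 1 / Max (range l)"
    by (simp add: dim)
  have "Max (range l) \<in> range l" by (intro Max_in) auto
  then obtain i0 where i0: "Max (range l) = l i0" by (rule rangeE)
  have "\<exists>r. 1 / l i = ereal r \<and> 0 \<le> r \<and> r \<le> 1" for i using one_div_ereal_cases[OF l] by blast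
  then obtain r where r: "\<And>i. 1 / l i = ereal (r i)" "\<And>i. 0 \<le> r i" "\<And>i. r i \<le> 1" by metis
  \<comment> \<open>The reciprocal at the maximal exponent is kept and each of the other
    \<open>n - 1\<close> is bounded by 1, which compares the sum with the exact dimension.\<close>
  have "(\<Sum>i\<in>UNIV. r i) = r i0 + (\<Sum>i\<in>UNIV - {i0}. r i)" by (simp add: sum.remove)
  also have "(\<Sum>i\<in>UNIV - {i0}. r i) \<le> (\<Sum>i\<in>UNIV - {i0}. 1)" by (intro sum_mono r)
  also have "\<dots> = real CARD('n) - 1" by (simp add: of_nat_diff Suc_leI)
  finally have "(\<Sum>i\<in>UNIV. r i) \<le> real CARD('n) - 1 + r i0" by simp
  then show "max (ereal (real CARD('n) - 1)) (\<Sum>i\<in>UNIV. 1 / l i) \<le> hausdorff_dim (badic_level_prod b l)"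
    unfolding dim i0 r(1) using r(2)[of i0] by simp
next
  assume n: "2 \<le> CARD('n)"
  \<comment> \<open>The threshold 3 serves all \<open>n \<ge> 2\<close> at once: each factor has
    dimension at most 1/3, and \<open>n / 3 < n - 1\<close>, which bounds the product from
    below.\<close>
  have "(\<Sum>i\<in>UNIV. hausdorff_dim (badic_level_set b (l i))) < hausdorff_dim (badic_level_prod b l)"
    if b: "2 \<le> b" and l: "\<And>i. 1 \<le> l i" "\<And>i. ereal 3 < l i" for b and l :: "'n \<Rightarrow> ereal"
  proof -
    have "hausdorff_dim (badic_level_set b (l i)) \<le> ereal (1 / 3)" for i
    proof -
      have "hausdorff_dim (badic_level_set b (l i)) \<le> ereal (real DIM(real) - 1) + 1 / l i"
        using b l by (intro hausdorff_dim_le_of_badic_exponent[where i = 1]) (auto simp: badic_level_set_def)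
      also have "\<dots> = 1 / l i" by simp
      also have "\<dots> \<le> 1 / ereal 3" using l by (intro one_div_ereal_antimono) (auto intro: less_imp_le)
      also have "\<dots> = ereal (1 / 3)" by (rule one_div_ereal_real) simp
      finally show ?thesis .
    qed
    then have "(\<Sum>i\<in>UNIV. hausdorff_dim (badic_level_set b (l i))) \<le> (\<Sum>i\<in>(UNIV :: 'n set). ereal (1 / 3))"
      by (intro sum_mono)
    also have "\<dots> = ereal (CARD('n) / 3)" by simp
    also have "\<dots> < ereal (real CARD('n) - 1)" using n by simp
    also have "\<dots> \<le> hausdorff_dim (badic_level_prod b l)"
    proof -
      have "1 \<le> Max (range l)" using l(1) by (meson Max_ge UNIV_I finite finite_imageI image_eqI order.trans)
      then obtain c where "1 / Max (range l) = ereal c" "0 \<le> c" using one_div_ereal_cases by blast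
      then show ?thesis unfolding hausdorff_dim_badic_level_prod[where l = l, OF b l(1)] by simp
    qed
    finally show ?thesis .
  qed
  then show "\<exists>T::real. \<forall>b\<ge>2. \<forall>l :: 'n \<Rightarrow> ereal. (\<forall>i. 1 \<le> l i) \<and> (\<forall>i. l i > ereal T) \<longrightarrow>
      hausdorff_dim (badic_level_prod b l) > (\<Sum>i\<in>UNIV. hausdorff_dim (badic_level_set b (l i)))"
    by blast
next
  fix b :: nat assume b: "2 \<le> b"
  have ge1: "eventually (\<lambda>l :: 'n \<Rightarrow> ereal. \<forall>i. 1 \<le> l i) max_to_infinity"
    unfolding max_to_infinity_def going_to_within_def eventually_inf_principal by simp
  have lim: "((\<lambda>l :: 'n \<Rightarrow> ereal. Max (range l)) \<longlongrightarrow> \<infinity>) max_to_infinity"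
    unfolding max_to_infinity_def by (rule filterlim_going_toI_weak)
  have "((\<lambda>l :: 'n \<Rightarrow> ereal. 1 / Max (range l)) \<longlongrightarrow> 0) max_to_infinity"
    using tendsto_inverse_ereal[OF lim] by simp
  then have "((\<lambda>l :: 'n \<Rightarrow> ereal. ereal (real CARD('n) - 1) + 1 / Max (range l)) \<longlongrightarrow> ereal (real CARD('n) - 1) + 0)
      max_to_infinity"
    by (intro tendsto_add_ereal tendsto_const) auto
  \<comment> \<open>The filter is restricted to parameters that are all at least 1, so the exact
    formula holds eventually and transfers the limit.\<close>
  moreover have "eventually (\<lambda>l :: 'n \<Rightarrow> ereal. ereal (real CARD('n) - 1) + 1 / Max (range l)
      = hausdorff_dim (badic_level_prod b l)) max_to_infinity"
    using ge1 by eventually_elim (simp add: hausdorff_dim_badic_level_prod[OF b])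
  ultimately show "((\<lambda>l :: 'n \<Rightarrow> ereal. hausdorff_dim (badic_level_prod b l)) \<longlongrightarrow> ereal (real CARD('n) - 1))
      max_to_infinity"
    by (auto intro: Lim_transform_eventually)
  have "eventually (\<lambda>l :: 'n \<Rightarrow> ereal. packing_dim (badic_level_prod b l) = ereal (real CARD('n))) max_to_infinity"
    using ge1 by eventually_elim (simp add: packing_dim_badic_level_prod[OF b])
  then show "((\<lambda>l :: 'n \<Rightarrow> ereal. packing_dim (badic_level_prod b l)) \<longlongrightarrow> ereal (real CARD('n))) max_to_infinity"
    by (rule tendsto_eventually)
qed

end
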